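(* Let $d\geq 3$ be a fixed integer, $n$ a positive integer and $0<p<1$. Let $P(G(n,p),d)$ be the probability that a random graph from $G(n,p)$ has diameter at most $d$. Suppose that $$n^{\frac{1}{d}-1}\leq p\leq n^{\frac{1}{d}+\frac{1}{2d^2}-1}\qquad\text{and}\qquad (4^dd)^{2d^2}<n.$$ Then $$P(G(n,p),d)>1-\binom{n}{2}(1-p^d)^{n^{d-1}}\left(1+4^{d+1}d\,n^{\frac{-1}{2d^2}}\right)$$ and $$P(G(n,p),d)<\frac{2(1-p^d)^{-n^{d-1}}\left(1+2n^{\frac{-1}{2d^2}}\right)}{n(n-1)}+4^{d+2}d\,n^{\frac{-1}{2d^2}}.$$
   Context: $G(n,p)$ denotes the model of simple graphs on $n$ labelled vertices in which each of the $\binom n2$ possible edges is present independently with probability $p$. The diameter of a graph is the maximum over pairs of vertices of their graph distance (infinite if the graph is disconnected). *)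

theory Defs
  imports "HOL-Probability.Product_PMF" "Graph_Theory.Graph_Theory"
begin

text \<open>
  A simple undirected graph is a \<open>pair_graph\<close>: a finite, loop-free digraph without parallel arcs
  whose arc relation is symmetric, so that an edge \<open>{u, v}\<close> is the pair of arcs
  \<open>(u, v)\<close>, \<open>(v, u)\<close>.
\<close>

definition vertex_pairs :: "nat \<Rightarrow> nat set set" where
  "vertex_pairs n = {e. e \<subseteq> {..<n} \<and> card e = 2}"

definition graph_of_edges :: "nat \<Rightarrow> nat set set \<Rightarrow> nat pair_pre_digraph" where
  "graph_of_edges n E = \<lparr> pverts = {..<n}, parcs = {(u, v). {u, v} \<in> E \<inter> vertex_pairs n} \<rparr>"

definition random_graph :: "nat \<Rightarrow> real \<Rightarrow> nat pair_pre_digraph pmf" where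
  "random_graph n p =
     map_pmf (\<lambda>present. graph_of_edges n {e. present e})
       (Pi_pmf (vertex_pairs n) False (\<lambda>_. bernoulli_pmf p))"

text \<open>
  With all arcs of cost 1, the shortest-path cost \<open>\<mu>\<close> is the usual graph distance;
  it is \<open>\<infinity>\<close> for vertices in different components.
\<close>

definition graph_dist :: "'a pair_pre_digraph \<Rightarrow> 'a \<Rightarrow> 'a \<Rightarrow> ereal" where
  "graph_dist G u v = wf_digraph.\<mu> (with_proj G) (\<lambda>_. 1) u v"

text \<open>On a finite nonempty vertex set the supremum is a maximum.\<close>

definition graph_diameter :: "'a pair_pre_digraph \<Rightarrow> ereal" where
  "graph_diameter G = (SUP (u, v) \<in> pverts G \<times> pverts G. graph_dist G u v)"

lemma finite_vertex_pairs: "finite (vertex_pairs n)"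
  unfolding vertex_pairs_def by simp

text \<open>The constant \<open>\<mu>\<close> is specified only for well-formed digraphs, and every outcome is one.\<close>

lemma pair_graph_graph_of_edges: "pair_graph (graph_of_edges n E)"
proof
  fix e assume "e \<in> parcs (graph_of_edges n E)"
  then show "fst e \<in> pverts (graph_of_edges n E)" "snd e \<in> pverts (graph_of_edges n E)"
    "fst e \<noteq> snd e"
    by (auto simp: graph_of_edges_def vertex_pairs_def)
next
  show "finite (pverts (graph_of_edges n E))" by (simp add: graph_of_edges_def)
  have "parcs (graph_of_edges n E) \<subseteq> {..<n} \<times> {..<n}"
    by (auto simp: graph_of_edges_def vertex_pairs_def)
  then show "finite (parcs (graph_of_edges n E))"
    by (rule finite_subset) simp
  show "symmetric (with_proj (graph_of_edges n E))"
    by (auto simp: symmetric_def sym_def graph_of_edges_def insert_commute)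
qed

lemma pair_graph_random_graph: "G \<in> set_pmf (random_graph n p) \<Longrightarrow> pair_graph G"
  by (auto simp: random_graph_def pair_graph_graph_of_edges)

lemma graph_dist_le_iff:
  assumes "wf_digraph (with_proj G)"
  shows "graph_dist G u v \<le> ereal (real d) \<longleftrightarrow>
    (\<exists>q. pre_digraph.awalk (with_proj G) u q v \<and> length q \<le> d)"
proof -
  interpret wf_digraph "with_proj G" by fact
  have cost: "awalk_cost (\<lambda>_. 1) q = real (length q)" for q :: "('a \<times> 'a) list"
    by (induction q) auto
  have "(\<exists>q. awalk u q v \<and> length q \<le> d)" if le: "graph_dist G u v \<le> ereal (real d)"
  proof (rule ccontr)
    assume neg: "\<not> (\<exists>q. awalk u q v \<and> length q \<le> d)"
    have "ereal (real (Suc d)) \<le> \<mu> (\<lambda>_. 1) u v"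
      unfolding \<mu>_def
    proof (rule INF_greatest)
      fix q assume "q \<in> {q. awalk u q v}"
      with neg have "Suc d \<le> length q" by (auto simp: not_le)
      then show "ereal (real (Suc d)) \<le> ereal (awalk_cost (\<lambda>_. 1) q)"
        unfolding cost by simp
    qed
    from this le[unfolded graph_dist_def] have "ereal (real (Suc d)) \<le> ereal (real d)"
      by (rule order_trans)
    then show False by simp
  qed
  moreover have "graph_dist G u v \<le> ereal (real d)" if "awalk u q v" "length q \<le> d" for q
    using min_cost_le_walk_cost[OF that(1), of "\<lambda>_. 1"] that(2) unfolding graph_dist_def cost
    by (meson ereal_less_eq(3) of_nat_le_iff order_trans)
  ultimately show ?thesis by blast
qed

lemma graph_diameter_le_iff:
  assumes "wf_digraph (with_proj G)"
  shows "graph_diameter G \<le> ereal (real d) \<longleftrightarrow>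
    (\<forall>u \<in> pverts G. \<forall>v \<in> pverts G. \<exists>q. pre_digraph.awalk (with_proj G) u q v \<and> length q \<le> d)"
  unfolding graph_diameter_def by (auto simp: SUP_le_iff graph_dist_le_iff[OF assms])

definition prob_diameter_le :: "nat \<Rightarrow> real \<Rightarrow> nat \<Rightarrow> real" where
  "prob_diameter_le n p d =
     measure_pmf.prob (random_graph n p) {G. graph_diameter G \<le> ereal (real d)}"

end

(*
  Fix a pair of vertices u, v. It is at distance more than d exactly when the random edge set
  contains none of the edge sets of the paths of length at most d from u to v. Both directions come
  from one identity for a random subset R: forcing a set U into R costs a factor p^|U| and replaces
  R by R Un U. It gives the product lower bound for avoiding a family of sets, and, by Boppana and
  Spencer's argument, the upper bound of Janson's inequality. The paths of length d contribute
  (1 - p^d)^(n^(d-1)) up to a factor 1 + O(1/N), where N = n^(1/(2d^2)): shorter paths, paths lost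
  to repeated vertices and correlations between paths sharing edges are all of relative size 1/N,
  since N^(2d) <= np <= N^(2d+1). The first inequality is then a union bound over pairs. For the
  second, Janson's inequality applied to the paths of two pairs at once shows that the events for
  different pairs are nearly independent, and Chebyshev's inequality applies to the number of pairs
  at distance more than d.
*)

theory Submission
  imports Defs
begin

section \<open>Random subsets and Janson's inequality\<close>

definition random_subset :: "'a set \<Rightarrow> real \<Rightarrow> 'a set pmf" where
  "random_subset A p = map_pmf Collect (Pi_pmf A False (\<lambda>_. bernoulli_pmf p))"

lemma set_random_subset:
  assumes "finite A" "R \<in> set_pmf (random_subset A p)"
  shows "R \<subseteq> A"
  using assms set_Pi_pmf_subset[of A False "\<lambda>_. bernoulli_pmf p"]
  by (auto simp: random_subset_def)

lemma prob_random_subset_insert: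
  assumes "finite A" "x \<notin> A" "0 \<le> p" "p \<le> 1"
  shows "measure_pmf.prob (random_subset (insert x A) p) {R. Q R} =
    p * measure_pmf.prob (random_subset A p) {R. Q (insert x R)} +
    (1 - p) * measure_pmf.prob (random_subset A p) {R. Q R}"
proof -
  let ?P = "Pi_pmf A False (\<lambda>_. bernoulli_pmf p)"
  \<comment> \<open>Off \<open>A\<close> the product measure takes the default value
    \<open>False\<close>, so overwriting coordinate \<open>x\<close> either inserts \<open>x\<close>
    or leaves the set as it was.\<close>
  have upd: "Collect (f(x := y)) = (if y then insert x (Collect f) else Collect f)"
    if "f \<in> set_pmf ?P" for f y
  proof -
    have "\<not> f x"
      using set_Pi_pmf_subset[OF assms(1), of False "\<lambda>_. bernoulli_pmf p"] that assms(2) by blast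
    then show ?thesis by (cases y) (auto split: if_splits)
  qed
  have "random_subset (insert x A) p =
    bernoulli_pmf p \<bind> (\<lambda>y. map_pmf (\<lambda>R. if y then insert x R else R) (random_subset A p))"
    unfolding random_subset_def Pi_pmf_insert'[OF assms(1,2)]
    unfolding map_bind_pmf map_pmf_comp map_return_pmf
    unfolding map_pmf_def by (intro bind_pmf_cong refl) (simp only: upd)
  then have "measure_pmf.prob (random_subset (insert x A) p) {R. Q R} =
    measure_pmf.expectation (bernoulli_pmf p)
      (\<lambda>y. measure_pmf.prob (map_pmf (\<lambda>R. if y then insert x R else R) (random_subset A p)) {R. Q R})"
    by (simp only: measure_pmf_bind)
       (rule measure_pmf.measure_bind[where N = "count_space UNIV"], auto simp: measure_subprob)
  then show ?thesis
    using assms(3,4) by (simp add: vimage_def)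
qed

lemma prob_mem_random_subset:
  assumes "finite A" "x \<in> A" "0 \<le> p" "p \<le> 1"
  shows "measure_pmf.prob (random_subset A p) {R. x \<in> R \<and> Q R} =
    p * measure_pmf.prob (random_subset A p) {R. Q (insert x R)}"
proof -
  let ?B = "A - {x}"
  have A: "A = insert x ?B" using assms by auto
  \<comment> \<open>A random subset of \<open>A - {x}\<close> never contains \<open>x\<close>, so
    only the branch that inserts \<open>x\<close> survives.\<close>
  have "measure_pmf.prob (random_subset ?B p) {R. x \<in> R \<and> Q R} = 0"
    using set_random_subset[of ?B _ p] assms(1) by (auto simp: measure_pmf_zero_iff)
  then show ?thesis
    using assms
    by (subst (1 2) A) (simp add: prob_random_subset_insert algebra_simps del: insert_Diff_single)
qed

text \<open>Conditioned on containing \<open>U\<close>, the random set has the law of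
  \<open>R Un U\<close>, because the remaining elements are independent of \<open>U\<close>. All
  correlation estimates rest on this identity.\<close>

lemma prob_subset_random_subset:
  assumes "finite A" "U \<subseteq> A" "0 \<le> p" "p \<le> 1"
  shows "measure_pmf.prob (random_subset A p) {R. U \<subseteq> R \<and> Q R} =
    p ^ card U * measure_pmf.prob (random_subset A p) {R. Q (R \<union> U)}"
proof -
  have "finite U" using assms finite_subset by auto
  then show ?thesis using assms(2)
  proof (induction U arbitrary: Q rule: finite_induct)
    case (insert x U)
    have "measure_pmf.prob (random_subset A p) {R. insert x U \<subseteq> R \<and> Q R} =
      measure_pmf.prob (random_subset A p) {R. x \<in> R \<and> (U \<subseteq> R \<and> Q R)}"
      by (rule arg_cong[where f = "measure_pmf.prob _"]) auto
    also have "\<dots> = p * measure_pmf.prob (random_subset A p) {R. U \<subseteq> insert x R \<and> Q (insert x R)}"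
      using assms insert by (subst prob_mem_random_subset) auto
    also have "{R. U \<subseteq> insert x R \<and> Q (insert x R)} = {R. U \<subseteq> R \<and> Q (insert x R)}"
      using insert by auto
    also have "measure_pmf.prob (random_subset A p) \<dots> =
        p ^ card U * measure_pmf.prob (random_subset A p) {R. Q (R \<union> insert x U)}"
      using insert by simp
    finally show ?case using insert by simp
  qed simp
qed

section \<open>Avoiding a family of sets: product lower bound and Janson's upper bound\<close>

definition avoids :: "('i \<Rightarrow> 'a set) \<Rightarrow> 'i set \<Rightarrow> 'a set \<Rightarrow> bool" where
  "avoids S I R \<longleftrightarrow> (\<forall>i\<in>I. \<not> S i \<subseteq> R)"

locale random_subset_avoidance =
  fixes A :: "'a set" and p :: real
  assumes finite_ground: "finite A" and p_nonneg: "0 \<le> p" and p_le_one: "p \<le> 1"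
begin

abbreviation prob :: "('a set \<Rightarrow> bool) \<Rightarrow> real" where
  "prob Q \<equiv> measure_pmf.prob (random_subset A p) {R. Q R}"

lemma prob_avoids_insert:
  "prob (avoids S (insert i I)) =
    prob (avoids S I) - prob (\<lambda>R. S i \<subseteq> R \<and> avoids S I R)"
proof -
  have "prob (avoids S I) =
      prob (avoids S (insert i I)) + prob (\<lambda>R. S i \<subseteq> R \<and> avoids S I R)"
    by (subst measure_pmf.finite_measure_Union[symmetric])
       (auto simp: avoids_def intro!: arg_cong[where f = "measure_pmf.prob _"])
  then show ?thesis by simp
qed

text \<open>Negative correlation: if \<open>R Un U\<close> avoids the family, then so does the
  smaller set \<open>R\<close>.\<close>

lemma prob_subset_avoids_le:
  assumes "U \<subseteq> A"
  shows "prob (\<lambda>R. U \<subseteq> R \<and> avoids S I R) \<le> p ^ card U * prob (avoids S I)"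
  unfolding prob_subset_random_subset[OF finite_ground assms p_nonneg p_le_one]
  using p_nonneg
  by (intro mult_left_mono measure_pmf.finite_measure_mono) (auto simp: avoids_def)

text \<open>The sets are added one at a time; by negative correlation each new one costs at most the
  factor it would cost under independence.\<close>

lemma prob_avoids_ge:
  assumes "finite I" "\<And>i. i \<in> I \<Longrightarrow> S i \<subseteq> A"
  shows "prob (avoids S I) \<ge> (\<Prod>i\<in>I. 1 - p ^ card (S i))"
  using assms
proof (induction I rule: finite_induct)
  case empty
  then show ?case by (simp add: avoids_def)
next
  case (insert i I)
  have "(\<Prod>j\<in>insert i I. 1 - p ^ card (S j)) \<le> (1 - p ^ card (S i)) * prob (avoids S I)"
    using insert p_nonneg p_le_one by (auto intro!: mult_left_mono simp: power_le_one)
  also have "\<dots> \<le> prob (avoids S (insert i I))"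
    using prob_subset_avoids_le[of "S i" S I] insert
    by (simp add: prob_avoids_insert algebra_simps)
  finally show ?case .
qed

text \<open>The Boppana--Spencer argument for Janson's inequality. Given the present sets already
  avoided, only those meeting \<open>S i\<close> correlate with \<open>S i\<close>; dropping them gives an independent
  event, and they are put back by a union bound.\<close>

lemma prob_subset_avoids_ge:
  assumes "finite I" "\<And>j. j \<in> insert i I \<Longrightarrow> S j \<subseteq> A"
  shows "prob (\<lambda>R. S i \<subseteq> R \<and> avoids S I R) \<ge>
    (p ^ card (S i) - (\<Sum>j | j \<in> I \<and> S i \<inter> S j \<noteq> {}. p ^ card (S i \<union> S j))) * prob (avoids S I)"
    (is "_ \<ge> (_ - ?\<delta>) * _")
\<comment> \<open>If the correlation sum exceeds \<open>p ^ card (S i)\<close>, the claimed bound is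
  at most 0. Otherwise the factor is nonnegative, which the final monotonicity step
  requires.\<close>
proof (cases "?\<delta> \<le> p ^ card (S i)")
  case False
  then have "(p ^ card (S i) - ?\<delta>) * prob (avoids S I) \<le> 0"
    by (simp add: mult_nonpos_nonneg)
  also have "0 \<le> prob (\<lambda>R. S i \<subseteq> R \<and> avoids S I R)" by simp
  finally show ?thesis .
next
  case True
  define D where "D = {j \<in> I. S i \<inter> S j \<noteq> {}}"
  define C where "C = {j \<in> I. S i \<inter> S j = {}}"
  have "prob (\<lambda>R. S i \<subseteq> R \<and> avoids S C R) = p ^ card (S i) * prob (\<lambda>R. avoids S C (R \<union> S i))"
    using assms by (intro prob_subset_random_subset finite_ground p_nonneg p_le_one) auto
  \<comment> \<open>The sets indexed by \<open>C\<close> are disjoint from \<open>S i\<close>, so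
    adding \<open>S i\<close> to \<open>R\<close> cannot complete any of them.\<close>
  also have "(\<lambda>R. avoids S C (R \<union> S i)) = avoids S C"
    by (auto simp: avoids_def C_def fun_eq_iff)
  finally have indep: "prob (\<lambda>R. S i \<subseteq> R \<and> avoids S C R) = p ^ card (S i) * prob (avoids S C)" .
  have "prob (\<lambda>R. S i \<subseteq> R \<and> avoids S C R) \<le>
      measure_pmf.prob (random_subset A p) ({R. S i \<subseteq> R \<and> avoids S I R} \<union>
        (\<Union>j\<in>D. {R. S i \<union> S j \<subseteq> R \<and> avoids S C R}))"
    by (rule measure_pmf.finite_measure_mono) (auto simp: avoids_def D_def C_def)
  also have "\<dots> \<le> prob (\<lambda>R. S i \<subseteq> R \<and> avoids S I R) +
      measure_pmf.prob (random_subset A p) (\<Union>j\<in>D. {R. S i \<union> S j \<subseteq> R \<and> avoids S C R})"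
    by (rule measure_Un_le) auto
  also have "measure_pmf.prob (random_subset A p) (\<Union>j\<in>D. {R. S i \<union> S j \<subseteq> R \<and> avoids S C R}) \<le>
      (\<Sum>j\<in>D. prob (\<lambda>R. S i \<union> S j \<subseteq> R \<and> avoids S C R))"
    using assms(1) by (intro measure_pmf.finite_measure_subadditive_finite) (auto simp: D_def)
  also have "\<dots> \<le> (\<Sum>j\<in>D. p ^ card (S i \<union> S j) * prob (avoids S C))"
    using assms by (intro sum_mono prob_subset_avoids_le) (auto simp: D_def)
  also have "\<dots> = ?\<delta> * prob (avoids S C)"
    by (simp add: D_def sum_distrib_right)
  finally have "(p ^ card (S i) - ?\<delta>) * prob (avoids S C) \<le> prob (\<lambda>R. S i \<subseteq> R \<and> avoids S I R)"
    using indep by (simp add: algebra_simps)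
  moreover have "prob (avoids S I) \<le> prob (avoids S C)"
    by (rule measure_pmf.finite_measure_mono) (auto simp: avoids_def C_def)
  ultimately show ?thesis
    using True mult_left_mono[of "prob (avoids S I)" "prob (avoids S C)" "p ^ card (S i) - ?\<delta>"]
    by simp
qed

text \<open>Janson's inequality as a product: each new set multiplies the avoidance probability by
  at most \<open>1 - p ^ k\<close> plus the bound on its correlation sum.\<close>

lemma prob_avoids_le:
  assumes "finite I" "\<And>i. i \<in> I \<Longrightarrow> S i \<subseteq> A" "\<And>i. i \<in> I \<Longrightarrow> card (S i) = k"
    and "\<And>i. i \<in> I \<Longrightarrow> (\<Sum>j | j \<in> I - {i} \<and> S i \<inter> S j \<noteq> {}. p ^ card (S i \<union> S j)) \<le> \<delta>"
    and "0 \<le> \<delta>"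
  shows "prob (avoids S I) \<le> (1 - p ^ k + \<delta>) ^ card I"
  using assms(1-4)
proof (induction I rule: finite_induct)
  case empty
  then show ?case by simp
next
  case (insert i I)
  \<comment> \<open>Removing an index only shrinks the correlation sums, so the same bound serves
    throughout the induction.\<close>
  have mono: "(\<Sum>j | j \<in> I - {l} \<and> S l \<inter> S j \<noteq> {}. p ^ card (S l \<union> S j)) \<le> \<delta>"
    if "l \<in> insert i I" for l
    using insert.hyps p_nonneg insert.prems(3)[OF that]
    by (intro order_trans[OF sum_mono2 insert.prems(3)[OF that]]) auto
  have I: "I - {i} = I" using insert.hyps by auto
  have nn: "0 \<le> 1 - p ^ k + \<delta>"
    using assms(5) power_le_one[OF p_nonneg p_le_one, of k] by linarith
  have "(p ^ k - \<delta>) * prob (avoids S I) \<le> prob (\<lambda>R. S i \<subseteq> R \<and> avoids S I R)"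
    using mono[of i] insert.prems insert.hyps
    by (intro order_trans[OF _ prob_subset_avoids_ge] mult_right_mono) (auto simp: I)
  then have "prob (avoids S (insert i I)) \<le> (1 - p ^ k + \<delta>) * prob (avoids S I)"
    by (simp add: prob_avoids_insert algebra_simps)
  also have "\<dots> \<le> (1 - p ^ k + \<delta>) * (1 - p ^ k + \<delta>) ^ card I"
    using insert.IH insert.prems(1,2) mono nn by (intro mult_left_mono) auto
  finally show ?case using insert.hyps by simp
qed

end

section \<open>Paths and their edge sets\<close>

definition path_edges :: "'a list \<Rightarrow> 'a set set" where
  "path_edges xs = (\<lambda>i. {xs ! i, xs ! Suc i}) ` {..<length xs - 1}"

lemma finite_path_edges [simp]: "finite (path_edges xs)"
  by (simp add: path_edges_def)

lemma path_edgesI: "Suc i < length xs \<Longrightarrow> {xs ! i, xs ! Suc i} \<in> path_edges xs"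
  by (auto simp: path_edges_def)

lemma path_edgesE:
  assumes "e \<in> path_edges xs"
  obtains i where "Suc i < length xs" "e = {xs ! i, xs ! Suc i}"
  using assms by (auto simp: path_edges_def less_diff_conv)

lemma path_edges_Cons_Cons:
  "path_edges (x # y # zs) = insert {x, y} (path_edges (y # zs))"
proof -
  have "{..<length (x # y # zs) - 1} = insert 0 (Suc ` {..<length (y # zs) - 1})"
    by (simp add: lessThan_Suc_eq_insert_0)
  then show ?thesis by (simp add: path_edges_def image_image)
qed

lemma path_edges_singleton [simp]: "path_edges [x] = {}"
  by (simp add: path_edges_def)

lemma inj_on_path_edge:
  assumes "distinct xs"
  shows "inj_on (\<lambda>i. {xs ! i, xs ! Suc i}) {..<length xs - 1}"
  by (rule inj_onI) (auto simp: doubleton_eq_iff nth_eq_iff_index_eq[OF assms])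

lemma card_path_edges: "distinct xs \<Longrightarrow> card (path_edges xs) = length xs - 1"
  unfolding path_edges_def by (subst card_image[OF inj_on_path_edge]) auto

lemma path_edges_rev: "path_edges (rev xs) = path_edges xs"
proof -
  have sub: "path_edges (rev ys) \<subseteq> path_edges ys" for ys :: "'a list"
  proof
    fix e assume "e \<in> path_edges (rev ys)"
    then obtain i where i: "Suc i < length ys" "e = {rev ys ! i, rev ys ! Suc i}"
      by (auto elim: path_edgesE)
    define j where "j = length ys - Suc (Suc i)"
    have "e = {ys ! j, ys ! Suc j}" "Suc j < length ys"
      using i by (auto simp: rev_nth j_def Suc_diff_Suc)
    then show "e \<in> path_edges ys" by (auto intro: path_edgesI)
  qed
  show ?thesis using sub[of xs] sub[of "rev xs"] by auto
qed

lemma path_edges_subset_vertex_pairs: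
  assumes "distinct xs" "set xs \<subseteq> {..<n}"
  shows "path_edges xs \<subseteq> vertex_pairs n"
proof
  fix e assume "e \<in> path_edges xs"
  then obtain i where i: "Suc i < length xs" "e = {xs ! i, xs ! Suc i}"
    by (elim path_edgesE)
  moreover have "xs ! i \<in> {..<n}" "xs ! Suc i \<in> {..<n}"
    using i(1) subsetD[OF assms(2) nth_mem, of i] subsetD[OF assms(2) nth_mem, of "Suc i"] by auto
  moreover have "xs ! i \<noteq> xs ! Suc i"
    using nth_eq_iff_index_eq[OF assms(1), of i "Suc i"] i(1) by simp
  ultimately show "e \<in> vertex_pairs n"
    by (auto simp: vertex_pairs_def card_insert_if)
qed

text \<open>Both lists are traced from the common first vertex: the next edge of \<open>ys\<close>
  is an edge of \<open>xs\<close> at the current vertex, and it cannot be the one just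
  traversed.\<close>

lemma path_edges_inject_hd:
  assumes "distinct xs" "distinct ys" "length xs = length ys"
    and hd: "xs ! 0 = ys ! 0" and eq: "path_edges xs = path_edges ys"
  shows "xs = ys"
proof (rule nth_equalityI[OF assms(3)])
  fix i assume "i < length xs"
  then show "xs ! i = ys ! i"
  proof (induction i rule: less_induct)
    case (less i)
    show ?case
    proof (cases i)
      case 0
      then show ?thesis using hd by simp
    next
      case (Suc k)
      have k: "xs ! k = ys ! k" using less Suc by simp
      have "{ys ! k, ys ! Suc k} \<in> path_edges xs"
        unfolding eq using less.prems Suc assms(3) by (intro path_edgesI) simp
      then obtain j where j: "Suc j < length xs" "{ys ! k, ys ! Suc k} = {xs ! j, xs ! Suc j}"
        by (elim path_edgesE)
      have "xs ! k = xs ! j \<or> xs ! k = xs ! Suc j"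
        using j(2) k by auto
      then consider "k = j" | "k = Suc j"
        using j(1) less.prems Suc by (auto simp: nth_eq_iff_index_eq[OF assms(1)])
      then show ?thesis
      proof cases
        case 1
        then show ?thesis using j(2) k Suc by (auto simp: doubleton_eq_iff)
      next
        \<comment> \<open>Here \<open>ys\<close> would turn back along \<open>xs\<close> to the
          vertex visited just before, contradicting distinctness.\<close>
        case 2
        then have "ys ! Suc k = xs ! j" using j(2) k by (auto simp: doubleton_eq_iff)
        also have "xs ! j = ys ! j" using less Suc 2 by simp
        finally have "Suc k = j"
          using less.prems Suc assms(3) j(1) by (subst (asm) nth_eq_iff_index_eq[OF assms(2)]) auto
        then show ?thesis using 2 by simp
      qed
    qed
  qed
qed

text \<open>The ends of a path are the vertices of degree one.\<close>

lemma path_edges_eq_hd: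
  assumes "distinct xs" "distinct ys" "length xs = length ys" "2 \<le> length xs"
    and eq: "path_edges xs = path_edges ys"
  shows "hd ys \<in> {hd xs, last xs}"
proof (rule ccontr)
  assume no: "hd ys \<notin> {hd xs, last xs}"
  have ne: "xs \<noteq> []" "ys \<noteq> []" using assms by auto
  have "{ys ! 0, ys ! Suc 0} \<in> path_edges xs"
    unfolding eq using assms by (intro path_edgesI) auto
  then obtain k where "Suc k < length xs" "{ys ! 0, ys ! Suc 0} = {xs ! k, xs ! Suc k}"
    by (elim path_edgesE)
  then obtain i where i: "i < length xs" "ys ! 0 = xs ! i"
    by (metis Suc_lessD doubleton_eq_iff)
  have "i \<noteq> 0" "i \<noteq> length xs - 1"
    using no i(2) ne by (metis hd_conv_nth insertCI, metis hd_conv_nth insertCI last_conv_nth)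
  then obtain j where j: "i = Suc j" "Suc (Suc j) < length xs"
    using i(1) by (cases i) auto
  \<comment> \<open>The first vertex of \<open>ys\<close> lies on one edge of \<open>ys\<close>, but
    being internal in \<open>xs\<close> it lies on two edges of \<open>xs\<close>.\<close>
  have only: "e = {ys ! 0, ys ! Suc 0}" if "e \<in> path_edges ys" "ys ! 0 \<in> e" for e
  proof -
    obtain l where l: "Suc l < length ys" "e = {ys ! l, ys ! Suc l}"
      using \<open>e \<in> path_edges ys\<close> by (elim path_edgesE)
    then have "ys ! 0 = ys ! l \<or> ys ! 0 = ys ! Suc l" using that(2) by auto
    then have "0 = l \<or> 0 = Suc l"
      using l(1) by (metis Suc_lessD assms(2) gr_zeroI less_nat_zero_code nth_eq_iff_index_eq)
    then show ?thesis using l by auto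
  qed
  have "{xs ! j, xs ! Suc j} \<in> path_edges ys" "{xs ! Suc j, xs ! Suc (Suc j)} \<in> path_edges ys"
    unfolding eq[symmetric] using j by (auto intro: path_edgesI)
  then have "{xs ! j, xs ! Suc j} = {xs ! Suc j, xs ! Suc (Suc j)}"
    using only i(2) j(1) by (metis insertCI)
  then show False
    using j by (auto simp: doubleton_eq_iff nth_eq_iff_index_eq[OF assms(1)])
qed

text \<open>An edge set determines its path only up to reversal; the condition that the first vertex
  is below the last one fixes the direction.\<close>

lemma path_edges_inject:
  fixes xs ys :: "'a :: linorder list"
  assumes "distinct xs" "distinct ys" "length xs = length ys" "2 \<le> length xs"
    and "path_edges xs = path_edges ys" "hd xs < last xs" "hd ys < last ys"
  shows "xs = ys"
proof -
  have ne: "xs \<noteq> []" "ys \<noteq> []" using assms by auto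
  have "hd ys \<in> {hd xs, last xs}"
    using assms by (intro path_edges_eq_hd) auto
  moreover have "hd (rev ys) \<in> {hd xs, last xs}"
    using assms by (intro path_edges_eq_hd) (auto simp: path_edges_rev)
  ultimately have "hd xs = hd ys"
    using assms(6,7) by (auto simp: hd_rev)
  then show ?thesis
    using assms ne by (intro path_edges_inject_hd) (auto simp: hd_conv_nth)
qed

text \<open>Fix an edge \<open>m\<close> of \<open>ys\<close> that is not shared. A shared edge before \<open>m\<close> is charged to its
  right end and one after \<open>m\<close> to its left end, so distinct shared edges are charged to distinct
  internal vertices.\<close>

lemma card_shared_edges_le:
  assumes "distinct xs" "distinct ys" "length xs = length ys"
    and ne: "path_edges xs \<noteq> path_edges ys"
  shows "card (path_edges xs \<inter> path_edges ys) \<le>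
    card {i. 0 < i \<and> Suc i < length ys \<and> ys ! i \<in> set xs}"
proof -
  let ?e = "\<lambda>i. {ys ! i, ys ! Suc i}"
  \<comment> \<open>Both edge sets have the same size, so if one contained the other they would be
    equal.\<close>
  have "\<not> path_edges ys \<subseteq> path_edges xs"
    using assms by (metis card_path_edges card_subset_eq finite_path_edges)
  then obtain m where m: "Suc m < length ys" "?e m \<notin> path_edges xs"
    by (auto elim: path_edgesE)
  define T where "T = {i. Suc i < length ys \<and> ?e i \<in> path_edges xs}"
  define g where "g i = (if i < m then Suc i else i)" for i :: nat
  have fT: "finite T" by (rule finite_subset[of _ "{..<length ys}"]) (auto simp: T_def)
  have "path_edges xs \<inter> path_edges ys \<subseteq> ?e ` T"
    by (auto simp: T_def elim!: path_edgesE[of _ ys])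
  then have "card (path_edges xs \<inter> path_edges ys) \<le> card T"
    using fT by (meson card_image_le card_mono finite_imageI le_trans)
  \<comment> \<open>For positive \<open>m\<close> the map \<open>g\<close> sends both
    \<open>m - 1\<close> and \<open>m\<close> to \<open>m\<close>, so injectivity on
    \<open>T\<close> depends on \<open>m\<close> lying outside \<open>T\<close>.\<close>
  also have "m \<notin> T" using m by (auto simp: T_def)
  then have "inj_on g T"
    by (intro inj_onI) (auto simp: g_def split: if_splits, (metis Suc_lessI)+)
  then have "card T = card (g ` T)" by (simp add: card_image)
  also have "\<dots> \<le> card {i. 0 < i \<and> Suc i < length ys \<and> ys ! i \<in> set xs}"
  proof (rule card_mono)
    show "finite {i. 0 < i \<and> Suc i < length ys \<and> ys ! i \<in> set xs}"
      by (rule finite_subset[of _ "{..<length ys}"]) auto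
    show "g ` T \<subseteq> {i. 0 < i \<and> Suc i < length ys \<and> ys ! i \<in> set xs}"
    proof safe
      fix i assume i: "i \<in> T"
      then have "i \<noteq> m" using \<open>m \<notin> T\<close> by auto
      obtain k where "Suc k < length xs" "?e i = {xs ! k, xs ! Suc k}"
        using i by (auto simp: T_def elim: path_edgesE)
      then have "?e i \<subseteq> set xs" by auto
      then have *: "ys ! i \<in> set xs" "ys ! Suc i \<in> set xs" by auto
      then show "ys ! g i \<in> set xs" by (auto simp: g_def)
      show "0 < g i" using \<open>i \<noteq> m\<close> by (auto simp: g_def)
      show "Suc (g i) < length ys" using i m(1) by (auto simp: g_def T_def)
    qed
  qed
  finally show ?thesis .
qed

section \<open>Weighted counts of vertex lists\<close>

lemma sum_prod_list:
  fixes g :: "'a \<Rightarrow> 'b :: comm_semiring_1"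
  assumes "finite V"
  shows "(\<Sum>zs | set zs \<subseteq> V \<and> length zs = m. prod_list (map g zs)) = (\<Sum>x\<in>V. g x) ^ m"
proof (induction m)
  case 0
  have "{zs. set zs \<subseteq> V \<and> length zs = 0} = {[]}" by auto
  then show ?case by simp
next
  case (Suc m)
  have inj: "inj_on (\<lambda>(xs, x). x # xs) A" for A :: "('a list \<times> 'a) set"
    by (auto simp: inj_on_def)
  show ?case
    unfolding lists_length_Suc_eq sum.reindex[OF inj] power_Suc2 Suc[symmetric] sum_product
    by (simp add: case_prod_unfold sum.cartesian_product mult.commute)
qed

text \<open>The weight is a product over the entries, \<open>y\<close> for an entry in
  \<open>W\<close> and 1 for any other, so the sum over lists factors.\<close>

lemma sum_power_length_filter:
  fixes y :: "'b :: comm_semiring_1"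
  assumes "finite V"
  shows "(\<Sum>zs | set zs \<subseteq> V \<and> length zs = m. y ^ length (filter (\<lambda>x. x \<in> W) zs)) =
    (of_nat (card (V \<inter> W)) * y + of_nat (card (V - W))) ^ m"
proof -
  have "y ^ length (filter (\<lambda>x. x \<in> W) zs) = prod_list (map (\<lambda>x. if x \<in> W then y else 1) zs)"
    for zs by (induction zs) auto
  moreover have "(\<Sum>x\<in>V. if x \<in> W then y else 1) = of_nat (card (V \<inter> W)) * y + of_nat (card (V - W))"
    using assms by (simp add: sum.If_cases Diff_eq Collect_neg_eq)
  ultimately show ?thesis by (simp add: sum_prod_list[OF assms])
qed

text \<open>The mean value bound for the power function, proved by induction.\<close>

lemma power_diff_le:
  fixes x b :: real
  assumes "0 \<le> x" "0 \<le> b"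
  shows "(x + b) ^ Suc m - x ^ Suc m \<le> Suc m * b * (x + b) ^ m"
proof (induction m)
  case 0
  then show ?case by simp
next
  case (Suc m)
  have "(x + b) ^ Suc (Suc m) - x ^ Suc (Suc m) =
      (x + b) * ((x + b) ^ Suc m - x ^ Suc m) + b * x ^ Suc m"
    by (simp add: algebra_simps)
  also have "\<dots> \<le> (x + b) * (Suc m * b * (x + b) ^ m) + b * (x + b) ^ Suc m"
    using assms Suc by (intro add_mono mult_left_mono power_mono) auto
  also have "\<dots> = Suc (Suc m) * b * (x + b) ^ Suc m"
    by (simp add: algebra_simps)
  finally show ?case .
qed

text \<open>The lists meeting \<open>W\<close> are all lists minus those over \<open>V - W\<close>.
  Both sums are pure powers, and their difference gains the small factor
  \<open>card W * y\<close>.\<close>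

lemma sum_power_length_filter_le:
  fixes y :: real
  assumes "finite V" "W \<subseteq> V" "0 \<le> y"
  shows "(\<Sum>zs | set zs \<subseteq> V \<and> length zs = Suc m \<and> set zs \<inter> W \<noteq> {}.
      y ^ length (filter (\<lambda>x. x \<in> W) zs)) \<le> Suc m * (card W * y) * (card V + card W * y) ^ m"
proof -
  let ?f = "\<lambda>zs. y ^ length (filter (\<lambda>x. x \<in> W) zs)"
  let ?L = "\<lambda>V. {zs. set zs \<subseteq> V \<and> length zs = Suc m}"
  have disj: "(V - W) \<inter> W = {}" by auto
  have fin: "finite (?L V)" by (rule finite_lists_length_eq[OF assms(1)])
  have "{zs. set zs \<subseteq> V \<and> length zs = Suc m \<and> set zs \<inter> W \<noteq> {}} = ?L V - ?L (V - W)"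
    by auto
  then have "(\<Sum>zs | set zs \<subseteq> V \<and> length zs = Suc m \<and> set zs \<inter> W \<noteq> {}. ?f zs) =
      sum ?f (?L V) - sum ?f (?L (V - W))"
    using fin by (simp only:) (rule sum_diff, auto)
  also have "sum ?f (?L (V - W)) = card (V - W) ^ Suc m"
    using sum_power_length_filter[of "V - W" y W "Suc m"] assms(1) by (simp add: disj del: power_Suc)
  also have "sum ?f (?L V) = (card (V - W) + card W * y) ^ Suc m"
    unfolding sum_power_length_filter[OF assms(1)] using assms(2) by (simp add: Int_absorb1 add.commute)
  also have "\<dots> - card (V - W) ^ Suc m \<le>
      Suc m * (card W * y) * (card (V - W) + card W * y) ^ m"
    using power_diff_le[of "card (V - W)" "card W * y" m] assms(3) by simp
  also have "\<dots> \<le> Suc m * (card W * y) * (card V + card W * y) ^ m"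
    using assms by (intro mult_left_mono power_mono add_right_mono) (auto intro!: card_mono)
  finally show ?thesis .
qed


section \<open>Paths with given ends: counting and overlaps\<close>

definition paths :: "nat \<Rightarrow> nat \<Rightarrow> nat \<Rightarrow> nat \<Rightarrow> nat list set" where
  "paths n k u v =
    {xs. length xs = Suc k \<and> distinct xs \<and> set xs \<subseteq> {..<n} \<and> hd xs = u \<and> last xs = v}"

lemma paths_Suc_eq:
  assumes "u < n" "v < n" "u \<noteq> v"
  shows "paths n (Suc m) u v =
    (\<lambda>zs. u # zs @ [v]) ` {zs. length zs = m \<and> distinct zs \<and> set zs \<subseteq> {..<n} - {u, v}}"
    (is "_ = ?f ` ?Z")
proof
  show "?f ` ?Z \<subseteq> paths n (Suc m) u v"
    using assms by (auto simp: paths_def)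
  show "paths n (Suc m) u v \<subseteq> ?f ` ?Z"
  proof
    fix xs assume xs: "xs \<in> paths n (Suc m) u v"
    then obtain ys where ys: "xs = u # ys" "ys \<noteq> []"
      using assms(3) by (cases xs) (auto simp: paths_def split: if_splits)
    then obtain zs x where "ys = zs @ [x]" by (cases ys rule: rev_cases) auto
    with xs ys have "xs = ?f zs" "zs \<in> ?Z" by (auto simp: paths_def)
    then show "xs \<in> ?f ` ?Z" by blast
  qed
qed

lemma finite_paths [simp]: "finite (paths n k u v)"
  by (rule finite_subset[OF _ finite_lists_length_eq[of "{..<n}" "Suc k"]]) (auto simp: paths_def)

lemma card_path_edges_paths: "xs \<in> paths n k u v \<Longrightarrow> card (path_edges xs) = k"
  by (simp add: paths_def card_path_edges)

lemma paths_edges_subset: "xs \<in> paths n k u v \<Longrightarrow> path_edges xs \<subseteq> vertex_pairs n"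
  by (simp add: paths_def path_edges_subset_vertex_pairs)

lemma card_paths_le:
  assumes "u < n" "v < n" "u \<noteq> v"
  shows "card (paths n (Suc m) u v) \<le> n ^ m"
proof -
  have "card (paths n (Suc m) u v) \<le>
      card {zs. length zs = m \<and> distinct zs \<and> set zs \<subseteq> {..<n} - {u, v}}"
    unfolding paths_Suc_eq[OF assms]
    by (intro card_image_le finite_subset[OF _ finite_lists_length_eq[of "{..<n}" m]]) auto
  also have "\<dots> \<le> card {zs. set zs \<subseteq> {..<n} \<and> length zs = m}"
    by (intro card_mono finite_lists_length_eq) auto
  also have "\<dots> = n ^ m" by (simp add: card_lists_length_eq)
  finally show ?thesis .
qed

text \<open>The exact count is a falling factorial of \<open>m\<close> factors, running from
  \<open>n - 2\<close> down to \<open>n - Suc m\<close>.\<close>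

lemma card_paths_ge:
  assumes "u < n" "v < n" "u \<noteq> v" "m + 2 \<le> n"
  shows "(n - Suc m) ^ m \<le> card (paths n (Suc m) u v)"
proof -
  have V: "card ({..<n} - {u, v}) = n - 2"
    using assms by (simp add: card_Diff_subset)
  have "card (paths n (Suc m) u v) =
      card {zs. length zs = m \<and> distinct zs \<and> set zs \<subseteq> {..<n} - {u, v}}"
    unfolding paths_Suc_eq[OF assms(1-3)] by (intro card_image inj_onI) auto
  also have "\<dots> = \<Prod>{n - 2 - m + 1..n - 2}"
    using assms V by (subst card_lists_distinct_length_eq) auto
  also have "\<dots> \<ge> (\<Prod>i\<in>{n - 2 - m + 1..n - 2}. n - Suc m)"
    using assms(4) by (intro prod_mono) auto
  also have "(\<Prod>i\<in>{n - 2 - m + 1..n - 2}. n - Suc m) = (n - Suc m) ^ m"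
  proof -
    have "card {n - 2 - m + 1..n - 2} = m" using assms(4) by auto
    then show ?thesis by (simp only: prod_constant)
  qed
  finally show ?thesis .
qed

text \<open>Sharing \<open>j > 0\<close> edges with \<open>xs\<close> forces at least \<open>j\<close> internal vertices into \<open>set xs\<close>, which
  turns \<open>p ^ card (path_edges xs \<union> path_edges ys)\<close> into a product of vertex weights.\<close>

lemma sum_shared_paths_le:
  fixes p :: real
  assumes xs: "length xs = m + 3" "distinct xs" "set xs \<subseteq> {..<n}"
    and uv: "u < n" "v < n" "u \<noteq> v" and p: "0 < p" "p \<le> 1"
    and ne: "\<And>ys. ys \<in> paths n (m + 2) u v \<Longrightarrow> ys \<noteq> xs \<Longrightarrow> path_edges xs \<noteq> path_edges ys"
  shows "(\<Sum>ys | ys \<in> paths n (m + 2) u v - {xs} \<and> path_edges xs \<inter> path_edges ys \<noteq> {}.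
      p ^ card (path_edges xs \<union> path_edges ys)) \<le>
    real (Suc m) * real (m + 3) * p ^ (2 * m + 3) * (real n + real (m + 3) / p) ^ m"
proof -
  let ?f = "\<lambda>zs. u # zs @ [v]"
  let ?W = "set xs"
  let ?c = "\<lambda>zs. length (filter (\<lambda>x. x \<in> ?W) zs)"
  let ?A = "{ys. ys \<in> paths n (m + 2) u v - {xs} \<and> path_edges xs \<inter> path_edges ys \<noteq> {}}"
  let ?Z = "{zs. set zs \<subseteq> {..<n} \<and> length zs = Suc m \<and> set zs \<inter> ?W \<noteq> {}}"
  have shared: "0 < card (path_edges xs \<inter> path_edges (?f zs))"
      "card (path_edges xs \<inter> path_edges (?f zs)) \<le> ?c zs" if "?f zs \<in> ?A" for zs
  proof -
    have A: "?f zs \<in> paths n (m + 2) u v" "?f zs \<noteq> xs" "path_edges xs \<inter> path_edges (?f zs) \<noteq> {}"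
      using that by auto
    then show "0 < card (path_edges xs \<inter> path_edges (?f zs))"
      by (simp add: card_gt_0_iff)
    have "card (path_edges xs \<inter> path_edges (?f zs)) \<le>
        card {i. 0 < i \<and> Suc i < length (?f zs) \<and> ?f zs ! i \<in> ?W}"
      using A(1,2) ne xs by (intro card_shared_edges_le) (auto simp: paths_def)
    also have "{i. 0 < i \<and> Suc i < length (?f zs) \<and> ?f zs ! i \<in> ?W} =
        Suc ` {i. i < length zs \<and> zs ! i \<in> ?W}" (is "?L = _")
    proof -
      have "i \<in> ?L \<longleftrightarrow> i \<in> Suc ` {i. i < length zs \<and> zs ! i \<in> ?W}" for i
        by (cases i) (auto simp: nth_append)
      then show ?thesis by blast
    qed
    also have "card \<dots> = ?c zs"
      by (simp add: card_image length_filter_conv_card)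
    finally show "card (path_edges xs \<inter> path_edges (?f zs)) \<le> ?c zs" .
  qed
  have Aimg: "?A \<subseteq> ?f ` {zs \<in> ?Z. ?f zs \<in> ?A}"
  proof
    fix ys assume ys: "ys \<in> ?A"
    then obtain zs where zs: "ys = ?f zs" "length zs = Suc m" "set zs \<subseteq> {..<n}"
      using paths_Suc_eq[OF uv, of "Suc m"] by (auto simp: numeral_2_eq_2)
    moreover have "0 < ?c zs" using shared[of zs] ys zs(1) by auto
    then have "set zs \<inter> ?W \<noteq> {}" by (auto simp: length_greater_0_conv filter_empty_conv)
    ultimately show "ys \<in> ?f ` {zs \<in> ?Z. ?f zs \<in> ?A}" using ys by auto
  qed
  have finZ: "finite ?Z"
    by (rule finite_subset[OF _ finite_lists_length_eq[of "{..<n}" "Suc m"]]) auto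
  have inj: "inj_on ?f B" for B by (auto simp: inj_on_def)
  \<comment> \<open>The union has \<open>2 * m + 4\<close> edges minus the shared ones. Since
    \<open>1 / p\<close> is at least 1, replacing the number of shared edges by the larger number of
    hits in \<open>set xs\<close> only increases the weight.\<close>
  have wt: "p ^ card (path_edges xs \<union> path_edges (?f zs)) \<le> p ^ (2 * m + 4) * (1 / p) ^ ?c zs"
    if A: "?f zs \<in> ?A" for zs
  proof -
    let ?s = "card (path_edges xs \<inter> path_edges (?f zs))"
    have "card (path_edges xs) = m + 2" "card (path_edges (?f zs)) = m + 2"
      using A xs card_path_edges[of xs] by (auto simp: card_path_edges_paths)
    then have "card (path_edges xs \<union> path_edges (?f zs)) + ?s = 2 * m + 4"
      using card_Un_Int[of "path_edges xs" "path_edges (?f zs)"] by simp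
    then have "p ^ (2 * m + 4) = p ^ card (path_edges xs \<union> path_edges (?f zs)) * p ^ ?s"
      by (metis power_add)
    then have "p ^ card (path_edges xs \<union> path_edges (?f zs)) = p ^ (2 * m + 4) * (1 / p) ^ ?s"
      using p by (simp add: power_divide)
    also have "\<dots> \<le> p ^ (2 * m + 4) * (1 / p) ^ ?c zs"
      using p shared[OF A] by (intro mult_left_mono power_increasing) auto
    finally show ?thesis .
  qed
  have "(\<Sum>ys\<in>?A. p ^ card (path_edges xs \<union> path_edges ys)) \<le>
      (\<Sum>ys\<in>?f ` {zs \<in> ?Z. ?f zs \<in> ?A}. p ^ card (path_edges xs \<union> path_edges ys))"
    using p by (intro sum_mono2 Aimg finite_imageI finite_subset[OF _ finZ]) auto
  also have "\<dots> = (\<Sum>zs\<in>{zs \<in> ?Z. ?f zs \<in> ?A}. p ^ card (path_edges xs \<union> path_edges (?f zs)))"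
    by (simp add: sum.reindex[OF inj])
  also have "\<dots> \<le> (\<Sum>zs\<in>{zs \<in> ?Z. ?f zs \<in> ?A}. p ^ (2 * m + 4) * (1 / p) ^ ?c zs)"
    using wt by (intro sum_mono) auto
  also have "\<dots> \<le> (\<Sum>zs\<in>?Z. p ^ (2 * m + 4) * (1 / p) ^ ?c zs)"
    using p by (intro sum_mono2 finZ) auto
  also have "\<dots> = p ^ (2 * m + 4) * (\<Sum>zs\<in>?Z. (1 / p) ^ ?c zs)"
    by (simp add: sum_distrib_left)
  also have "\<dots> \<le> p ^ (2 * m + 4) *
      (Suc m * (card ?W * (1 / p)) * (card {..<n} + card ?W * (1 / p)) ^ m)"
    using p xs(3) by (intro mult_left_mono sum_power_length_filter_le) auto
  also have "card ?W = m + 3" using xs by (simp add: distinct_card)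
  also have "p ^ (2 * m + 4) * (Suc m * (real (m + 3) * (1 / p)) *
        (card {..<n} + real (m + 3) * (1 / p)) ^ m) =
      real (Suc m) * real (m + 3) * p ^ (2 * m + 3) * (real n + real (m + 3) / p) ^ m"
  proof -
    \<comment> \<open>One factor \<open>p\<close> cancels the \<open>1 / p\<close> of the forced
      hit, which lowers the exponent to \<open>2 * m + 3\<close>.\<close>
    have pow: "p ^ (2 * m + 4) = p * p ^ (2 * m + 3)"
      by (subst power_Suc[symmetric]) (simp add: add.commute)
    have "p * q * (a * (b * (1 / p)) * y) = a * b * q * y" for a b q y
      using p by simp
    then show ?thesis unfolding pow by simp
  qed
  finally show ?thesis .
qed

section \<open>From walks and diameter to avoided edge sets\<close>

lemma awalk_Cons_iff_edges:
  "pre_digraph.awalk (with_proj (graph_of_edges n E)) u (e # es) v \<longleftrightarrow>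
    u < n \<and> {u, snd e} \<in> E \<inter> vertex_pairs n \<and> fst e = u \<and>
    pre_digraph.awalk (with_proj (graph_of_edges n E)) (snd e) es v"
proof -
  interpret pair_graph "graph_of_edges n E" by (rule pair_graph_graph_of_edges)
  show ?thesis
    unfolding awalk_Cons_iff by (cases e) (auto simp: graph_of_edges_def vertex_pairs_def)
qed

lemma awalk_of_path:
  assumes "xs \<noteq> []" "distinct xs" "set xs \<subseteq> {..<n}" "path_edges xs \<subseteq> E"
  shows "pre_digraph.awalk (with_proj (graph_of_edges n E)) (hd xs) (zip xs (tl xs)) (last xs)"
  using assms
proof (induction xs rule: induct_list012)
  case (2 x)
  interpret pair_graph "graph_of_edges n E" by (rule pair_graph_graph_of_edges)
  have "awalk x [] x"
    unfolding awalk_Nil_iff using 2 by (simp add: graph_of_edges_def)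
  then show ?case by simp
next
  case (3 x y zs)
  have "{x, y} \<in> vertex_pairs n"
    using 3(3-5) by (auto simp: vertex_pairs_def card_insert_if)
  with 3 show ?case
    by (auto simp: awalk_Cons_iff_edges path_edges_Cons_Cons)
qed simp

text \<open>A shortest walk between the ends repeats no vertex, since a closed part could be cut
  out; its vertex list is the required path.\<close>

lemma path_of_awalk:
  assumes "pre_digraph.awalk (with_proj (graph_of_edges n E)) u q v" "length q \<le> d" "u \<noteq> v"
  shows "\<exists>k\<in>{1..d}. \<exists>xs\<in>paths n k u v. path_edges xs \<subseteq> E"
proof -
  interpret pair_graph "graph_of_edges n E" by (rule pair_graph_graph_of_edges)
  from assms(1) obtain q' where q': "awalk u q' v" "\<And>r. awalk u r v \<Longrightarrow> length q' \<le> length r"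
    using ex_has_least_nat[of "\<lambda>q. awalk u q v" q length] by blast
  have dist: "distinct (awalk_verts u q')"
  proof (rule ccontr)
    assume "\<not> distinct (awalk_verts u q')"
    then obtain r s t w where "q' = r @ s @ t" "s \<noteq> []" "awalk u r w" "awalk w t v"
      using awalk_not_distinct_decomp[OF q'(1)] by auto
    moreover from this have "length q' \<le> length (r @ t)"
      by (intro q'(2) awalk_appendI)
    ultimately show False by simp
  qed
  have edges: "path_edges (awalk_verts u r) \<subseteq> E" if "awalk u r v" for r
    using that
  proof (induction r arbitrary: u)
    case (Cons e r)
    have "path_edges (awalk_verts (snd e) r) \<subseteq> E" "{fst e, snd e} \<in> E" 
      using Cons by (auto simp: awalk_Cons_iff_edges)
    moreover obtain ws where "awalk_verts (snd e) r = snd e # ws"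
      using Cons.prems by (cases r) (auto simp: awalk_Cons_iff_edges)
    ultimately show ?case by (simp add: path_edges_Cons_Cons)
  qed simp
  have "q' \<noteq> []" using q'(1) assms(3) by auto
  then have "length q' \<in> {1..d}"
    using q'(2)[OF assms(1)] assms(2) by (cases q') auto
  moreover have "awalk_verts u q' \<in> paths n (length q') u v"
    using q'(1) dist awalkE[OF q'(1)]
    by (auto simp: paths_def length_awalk_verts graph_of_edges_def)
  ultimately show ?thesis using edges[OF q'(1)] by blast
qed

definition short_paths :: "nat \<Rightarrow> nat \<Rightarrow> nat \<times> nat \<Rightarrow> nat list set" where
  "short_paths n d = (\<lambda>(u, v). \<Union>k\<in>{1..d}. paths n k u v)"

text \<open>Each unordered pair appears once, smaller vertex first. This is the orientation that
  makes paths recoverable from their edge sets.\<close>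

definition ordered_pairs :: "nat \<Rightarrow> (nat \<times> nat) set" where
  "ordered_pairs n = {(u, v). u < v \<and> v < n}"

lemma graph_diameter_le_iff_short_paths:
  "graph_diameter (graph_of_edges n E) \<le> ereal (real d) \<longleftrightarrow>
    (\<forall>e\<in>ordered_pairs n. \<not> avoids path_edges (short_paths n d e) E)"
proof -
  interpret pair_graph "graph_of_edges n E" by (rule pair_graph_graph_of_edges)
  have verts: "pverts (graph_of_edges n E) = {..<n}" by (simp add: graph_of_edges_def)
  let ?P = "\<lambda>u v. \<exists>k\<in>{1..d}. \<exists>xs\<in>paths n k u v. path_edges xs \<subseteq> E"
  \<comment> \<open>Reversing a path allows the restriction to pairs with
    \<open>u < v\<close>.\<close>
  have rev: "?P v u" if "?P u v" for u v
  proof -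
    from that obtain k xs where k: "k \<in> {1..d}" "xs \<in> paths n k u v" "path_edges xs \<subseteq> E" by blast
    then have "rev xs \<in> paths n k v u" "path_edges (rev xs) \<subseteq> E"
      by (auto simp: paths_def path_edges_rev hd_rev last_rev)
    with k(1) show ?thesis by blast
  qed
  have walk: "(\<exists>q. awalk u q v \<and> length q \<le> d) \<longleftrightarrow> ?P u v" if "u \<noteq> v" for u v
  proof
    assume "\<exists>q. awalk u q v \<and> length q \<le> d"
    then show "?P u v" using path_of_awalk that by blast
  next
    assume "?P u v"
    then obtain k xs where k: "k \<in> {1..d}" "xs \<in> paths n k u v" "path_edges xs \<subseteq> E" by blast
    then have "xs \<noteq> []" by (auto simp: paths_def)
    then have "awalk u (zip xs (tl xs)) v"
      using k awalk_of_path[of xs n E] by (simp add: paths_def)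
    moreover have "length (zip xs (tl xs)) \<le> d"
      using k by (auto simp: paths_def)
    ultimately show "\<exists>q. awalk u q v \<and> length q \<le> d" by blast
  qed
  have refl: "\<exists>q. awalk u q u \<and> length q \<le> d" if "u < n" for u
    using that by (intro exI[of _ "[]"]) (auto simp: awalk_Nil_iff verts)
  have "graph_diameter (graph_of_edges n E) \<le> ereal (real d) \<longleftrightarrow>
      (\<forall>u<n. \<forall>v<n. \<exists>q. awalk u q v \<and> length q \<le> d)"
    using graph_diameter_le_iff[of "graph_of_edges n E" d] wf_digraph by (auto simp: verts)
  also have "\<dots> \<longleftrightarrow> (\<forall>u<n. \<forall>v<n. u \<noteq> v \<longrightarrow> ?P u v)"
    using walk refl by metis
  also have "\<dots> \<longleftrightarrow> (\<forall>u v. u < v \<longrightarrow> v < n \<longrightarrow> ?P u v)"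
  proof (intro iffI allI impI)
    fix u v assume "\<forall>u v. u < v \<longrightarrow> v < n \<longrightarrow> ?P u v" "u < n" "v < n" "u \<noteq> v"
    then show "?P u v" using rev[of v u] by (cases "u < v") (simp_all only: not_less le_neq_implies_less)
  next
    fix u v assume "\<forall>u<n. \<forall>v<n. u \<noteq> v \<longrightarrow> ?P u v" "u < v" "v < n"
    then show "?P u v" using less_trans[of u v n] by (simp only: less_not_refl2)
  qed
  also have "\<dots> \<longleftrightarrow> (\<forall>e\<in>ordered_pairs n. \<not> avoids path_edges (short_paths n d e) E)"
    by (auto simp: ordered_pairs_def avoids_def short_paths_def)
  finally show ?thesis .
qed

lemma finite_ordered_pairs: "finite (ordered_pairs n)"
  by (rule finite_subset[of _ "{..<n} \<times> {..<n}"]) (auto simp: ordered_pairs_def)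

lemma card_ordered_pairs: "card (ordered_pairs n) = n choose 2"
proof (induction n)
  case 0
  then show ?case by (simp add: ordered_pairs_def)
next
  case (Suc n)
  have "ordered_pairs (Suc n) = ordered_pairs n \<union> {..<n} \<times> {n}"
    by (auto simp: ordered_pairs_def)
  moreover have "card (ordered_pairs n \<union> {..<n} \<times> {n}) = card (ordered_pairs n) + card ({..<n} \<times> {n})"
    by (intro card_Un_disjoint finite_ordered_pairs) (auto simp: ordered_pairs_def)
  ultimately show ?case using Suc by (simp add: numeral_2_eq_2)
qed

lemma prob_diameter_le_eq:
  "prob_diameter_le n p d = measure_pmf.prob (random_subset (vertex_pairs n) p)
    {R. \<forall>e\<in>ordered_pairs n. \<not> avoids path_edges (short_paths n d e) R}"
proof -
  have "random_graph n p = map_pmf (graph_of_edges n) (random_subset (vertex_pairs n) p)"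
    by (simp add: random_graph_def random_subset_def map_pmf_comp)
  then show ?thesis
    by (simp add: prob_diameter_le_def vimage_def graph_diameter_le_iff_short_paths)
qed

section \<open>Second moment and path families\<close>

text \<open>Chebyshev's inequality for the number of events that occur, with mean \<open>m\<close>:
  when none occurs, its squared deviation is exactly \<open>m\<close> squared. The form without
  division also covers \<open>m = 0\<close>.\<close>

lemma prob_none_second_moment:
  fixes M :: "'a pmf" and B :: "'e \<Rightarrow> 'a set" and X :: "'e set" and m :: real
  defines "m \<equiv> \<Sum>e\<in>X. measure_pmf.prob M (B e)"
  shows "m\<^sup>2 * measure_pmf.prob M {x. \<forall>e\<in>X. x \<notin> B e} \<le>
    (\<Sum>e\<in>X. \<Sum>f\<in>X. measure_pmf.prob M (B e \<inter> B f)) - m\<^sup>2"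
proof (cases "finite X")
  case False
  then show ?thesis by (simp add: m_def)
next
  case True
  let ?Y = "\<lambda>x. \<Sum>e\<in>X. indicator (B e) x :: real"
  let ?Z = "\<lambda>x. \<Sum>e\<in>X. \<Sum>f\<in>X. indicator (B e \<inter> B f) x :: real"
  have int: "integrable (measure_pmf M) (indicator A :: 'a \<Rightarrow> real)" for A
    by (rule measure_pmf.integrable_const_bound[where B = 1]) auto
  have le: "m\<^sup>2 * indicator {x. \<forall>e\<in>X. x \<notin> B e} x \<le> ?Z x - 2 * m * ?Y x + m\<^sup>2" for x
  proof -
    have "?Z x = (?Y x)\<^sup>2"
      by (simp add: power2_eq_square sum_product indicator_inter_arith)
    then have "?Z x - 2 * m * ?Y x + m\<^sup>2 = (?Y x - m)\<^sup>2"
      by (simp add: power2_eq_square algebra_simps)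
    moreover have "?Y x = 0" if "\<forall>e\<in>X. x \<notin> B e" using that by simp
    ultimately show ?thesis by (auto simp: indicator_def)
  qed
  have "m\<^sup>2 * measure_pmf.prob M {x. \<forall>e\<in>X. x \<notin> B e} =
      measure_pmf.expectation M (\<lambda>x. m\<^sup>2 * indicator {x. \<forall>e\<in>X. x \<notin> B e} x)"
    by simp
  also have "\<dots> \<le> measure_pmf.expectation M (\<lambda>x. ?Z x - 2 * m * ?Y x + m\<^sup>2)"
    by (intro integral_mono le Bochner_Integration.integrable_add Bochner_Integration.integrable_diff
        integrable_mult_right Bochner_Integration.integrable_sum int measure_pmf.integrable_const)
  also have "\<dots> = (\<Sum>e\<in>X. \<Sum>f\<in>X. measure_pmf.prob M (B e \<inter> B f)) - 2 * m * m + m\<^sup>2"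
    by (simp add: int m_def)
  finally show ?thesis by (simp add: power2_eq_square)
qed

text \<open>The Weierstrass product inequality with multiplicities; Bernoulli's inequality handles
  each repeated factor.\<close>

lemma one_minus_sum_le_prod:
  fixes a :: "'a \<Rightarrow> real" and k :: "'a \<Rightarrow> nat"
  assumes "\<And>i. i \<in> I \<Longrightarrow> 0 \<le> a i" "\<And>i. i \<in> I \<Longrightarrow> a i \<le> 1"
  shows "1 - (\<Sum>i\<in>I. k i * a i) \<le> (\<Prod>i\<in>I. (1 - a i) ^ k i)"
  using assms
proof (induction I rule: infinite_finite_induct)
  case (insert i I)
  let ?P = "\<Prod>j\<in>I. (1 - a j) ^ k j"
  have P: "0 \<le> ?P" "?P \<le> 1"
    using insert.prems by (auto intro!: prod_nonneg prod_le_1 power_le_one)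
  have "1 - (k i * a i + (\<Sum>j\<in>I. k j * a j)) \<le> ?P - k i * a i"
    using insert by simp
  also have "\<dots> \<le> ?P - k i * a i * ?P"
    using P insert.prems[of i] mult_left_mono[of ?P 1 "k i * a i"] by simp
  also have "\<dots> = (1 + k i * (- a i)) * ?P" by (simp add: algebra_simps)
  also have "\<dots> \<le> (1 - a i) ^ k i * ?P"
    using Bernoulli_inequality[of "- a i" "k i"] P insert.prems(2)[of i] by (intro mult_right_mono) auto
  finally show ?case using insert by simp
qed auto

lemma paths_endpoints:
  "xs \<in> paths n k u v \<Longrightarrow> length xs = Suc k \<and> hd xs = u \<and> last xs = v"
  by (simp add: paths_def)

context
  fixes n :: nat and p :: real
  assumes p: "0 < p" "p < 1"
begin

interpretation random_subset_avoidance "vertex_pairs n" p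
  using p by unfold_locales (auto simp: finite_vertex_pairs)

lemma finite_short_paths: "finite (short_paths n d e)"
  by (auto simp: short_paths_def split: prod.split)

lemma prob_avoids_short_paths_ge:
  assumes "e \<in> ordered_pairs n"
  shows "(\<Prod>k=1..d. (1 - p ^ k) ^ (n ^ (k - 1))) \<le> prob (avoids path_edges (short_paths n d e))"
proof -
  obtain u v where e: "e = (u, v)" "u < v" "v < n"
    using assms by (auto simp: ordered_pairs_def)
  have pk: "0 \<le> 1 - p ^ k" "1 - p ^ k \<le> 1" for k
    using p by (auto simp: power_le_one)
  \<comment> \<open>Each factor is at most 1, so counting up to \<open>n ^ (k - 1)\<close> paths of
    length \<open>k\<close> instead of the actual number only decreases the product.\<close>
  have "(\<Prod>k=1..d. (1 - p ^ k) ^ (n ^ (k - 1))) \<le>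
      (\<Prod>k=1..d. (1 - p ^ k) ^ card (paths n k u v))"
  proof (intro prod_mono conjI)
    fix k assume "k \<in> {1..d}"
    then have "card (paths n k u v) \<le> n ^ (k - 1)"
      using card_paths_le[of u n v "k - 1"] e by auto
    then show "(1 - p ^ k) ^ (n ^ (k - 1)) \<le> (1 - p ^ k) ^ card (paths n k u v)"
      using pk by (intro power_decreasing) auto
  qed (use pk in auto)
  also have "\<dots> = (\<Prod>k=1..d. \<Prod>xs\<in>paths n k u v. 1 - p ^ card (path_edges xs))"
    by (intro prod.cong refl) (simp add: card_path_edges_paths)
  also have "\<dots> = (\<Prod>xs\<in>short_paths n d e. 1 - p ^ card (path_edges xs))"
    unfolding short_paths_def e(1) prod.case
    by (subst prod.UNION_disjoint) (auto dest!: paths_endpoints)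
  also have "\<dots> \<le> prob (avoids path_edges (short_paths n d e))"
    using finite_short_paths
    by (intro prob_avoids_ge) (auto simp: short_paths_def e(1) dest: paths_edges_subset)
  finally show ?thesis .
qed

text \<open>Only the paths of full length \<open>m + 2\<close> are kept, which enlarges the event,
  and Janson's inequality is applied to all pairs in \<open>T\<close> together. A path has
  correlation at most the single-pair bound with each pair's family, whence the factor
  \<open>card T\<close>.\<close>

lemma prob_avoids_all_short_paths_le:
  fixes \<delta> :: real and T :: "(nat \<times> nat) set" and m :: nat
  assumes T: "T \<subseteq> ordered_pairs n"
  defines "I \<equiv> \<Union>(u, v)\<in>T. paths n (m + 2) u v"
    and "\<delta> \<equiv> real (Suc m) * real (m + 3) * p ^ (2 * m + 3) * (real n + real (m + 3) / p) ^ m"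
  shows "prob (\<lambda>R. \<forall>e\<in>T. avoids path_edges (short_paths n (m + 2) e) R) \<le>
    (1 - p ^ (m + 2) + card T * \<delta>) ^ card I"
proof -
  have finT: "finite T" by (rule finite_subset[OF T finite_ordered_pairs])
  have finI: "finite I" using finT by (auto simp: I_def)
  have ordered: "hd xs < last xs" "last xs < n" "length xs = m + 3" "distinct xs" "set xs \<subseteq> {..<n}"
    if "xs \<in> I" for xs
    using that T by (auto simp: I_def paths_def ordered_pairs_def)
  have "prob (\<lambda>R. \<forall>e\<in>T. avoids path_edges (short_paths n (m + 2) e) R) \<le>
      prob (avoids path_edges I)"
    by (rule measure_pmf.finite_measure_mono) (fastforce simp: avoids_def short_paths_def I_def)+
  also have "\<dots> \<le> (1 - p ^ (m + 2) + card T * \<delta>) ^ card I"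
  proof (rule prob_avoids_le[OF finI])
    fix xs assume xs: "xs \<in> I"
    show "path_edges xs \<subseteq> vertex_pairs n" "card (path_edges xs) = m + 2"
      using ordered[OF xs] by (auto simp: card_path_edges dest: path_edges_subset_vertex_pairs)
    let ?A = "\<lambda>(u, v). {ys. ys \<in> paths n (m + 2) u v - {xs} \<and> path_edges xs \<inter> path_edges ys \<noteq> {}}"
    have "(\<Sum>ys | ys \<in> I - {xs} \<and> path_edges xs \<inter> path_edges ys \<noteq> {}. p ^ card (path_edges xs \<union> path_edges ys)) =
        (\<Sum>ys\<in>(\<Union>e\<in>T. ?A e). p ^ card (path_edges xs \<union> path_edges ys))"
      by (rule sum.cong) (auto simp: I_def)
    also have "\<dots> = (\<Sum>e\<in>T. \<Sum>ys\<in>?A e. p ^ card (path_edges xs \<union> path_edges ys))"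
      using finT by (intro sum.UNION_disjoint) (auto dest!: paths_endpoints)
    also have "\<dots> \<le> (\<Sum>e\<in>T. \<delta>)"
    proof (rule sum_mono)
      fix e assume e: "e \<in> T"
      obtain u v where uv: "e = (u, v)" "u < v" "v < n"
        using e T by (auto simp: ordered_pairs_def)
      \<comment> \<open>The path \<open>xs\<close> may join a different pair of \<open>T\<close>;
        the common orientation still rules out equal edge sets.\<close>
      have "path_edges xs \<noteq> path_edges ys" if "ys \<in> paths n (m + 2) u v" "ys \<noteq> xs" for ys
        using path_edges_inject[of xs ys] ordered[OF xs] that uv by (auto simp: paths_def)
      then show "(\<Sum>ys\<in>?A e. p ^ card (path_edges xs \<union> path_edges ys)) \<le> \<delta>"
        unfolding \<delta>_def uv(1) prod.case
        using ordered[OF xs] uv p by (intro sum_shared_paths_le) auto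
    qed
    finally show "(\<Sum>ys | ys \<in> I - {xs} \<and> path_edges xs \<inter> path_edges ys \<noteq> {}.
        p ^ card (path_edges xs \<union> path_edges ys)) \<le> card T * \<delta>"
      by simp
  next
    show "0 \<le> card T * \<delta>" using p by (simp add: \<delta>_def)
  qed
  finally show ?thesis .
qed

end

lemma card_UN_paths:
  assumes "T \<subseteq> ordered_pairs n"
  shows "card (\<Union>(u, v)\<in>T. paths n k u v) = (\<Sum>(u, v)\<in>T. card (paths n k u v))"
  using finite_subset[OF assms finite_ordered_pairs]
  by (subst card_UN_disjoint) (auto dest!: paths_endpoints intro!: sum.cong)

section \<open>Estimates in the given range of the edge probability\<close>

text \<open>In the second moment the diagonal contributes the mean, giving
  \<open>1 / (card X * q)\<close> after division, and the off-diagonal terms contribute the factor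
  \<open>r\<close> measuring near-independence.\<close>

lemma prob_none_second_moment_uniform:
  fixes M :: "'a pmf" and B :: "'e \<Rightarrow> 'a set" and q r :: real
  assumes X: "finite X" "X \<noteq> {}" and q: "0 < q" and r: "0 \<le> r"
    and lower: "\<And>e. e \<in> X \<Longrightarrow> q \<le> measure_pmf.prob M (B e)"
    and upper: "\<And>e f. e \<in> X \<Longrightarrow> f \<in> X \<Longrightarrow> e \<noteq> f \<Longrightarrow> measure_pmf.prob M (B e \<inter> B f) \<le> r * q\<^sup>2"
  shows "measure_pmf.prob M {x. \<forall>e\<in>X. x \<notin> B e} \<le> 1 / (card X * q) + r - 1"
proof -
  define m where "m = (\<Sum>e\<in>X. measure_pmf.prob M (B e))"
  have Q: "0 < card X * q" using X q by (simp add: card_gt_0_iff)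
  have m: "card X * q \<le> m"
    unfolding m_def using sum_mono[of X "\<lambda>_. q", OF lower] by simp
  have "(\<Sum>e\<in>X. \<Sum>f\<in>X. measure_pmf.prob M (B e \<inter> B f)) \<le>
      (\<Sum>e\<in>X. measure_pmf.prob M (B e) + card X * (r * q\<^sup>2))"
  proof (rule sum_mono)
    fix e assume e: "e \<in> X"
    have "(\<Sum>f\<in>X. measure_pmf.prob M (B e \<inter> B f)) =
        measure_pmf.prob M (B e) + (\<Sum>f\<in>X - {e}. measure_pmf.prob M (B e \<inter> B f))"
      using X e by (simp add: sum.remove)
    also have "(\<Sum>f\<in>X - {e}. measure_pmf.prob M (B e \<inter> B f)) \<le> (\<Sum>f\<in>X - {e}. r * q\<^sup>2)"
      using e by (intro sum_mono upper) auto
    also have "\<dots> \<le> (\<Sum>f\<in>X. r * q\<^sup>2)"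
      using X r by (intro sum_mono2) auto
    finally show "(\<Sum>f\<in>X. measure_pmf.prob M (B e \<inter> B f)) \<le>
        measure_pmf.prob M (B e) + card X * (r * q\<^sup>2)"
      by simp
  qed
  also have "\<dots> = m + r * (card X * q)\<^sup>2"
    by (simp add: sum.distrib m_def power2_eq_square algebra_simps)
  also have "\<dots> \<le> m + r * m\<^sup>2"
    using m Q r by (intro add_left_mono mult_left_mono power_mono) auto
  finally have "m\<^sup>2 * measure_pmf.prob M {x. \<forall>e\<in>X. x \<notin> B e} \<le> m + r * m\<^sup>2 - m\<^sup>2"
    using prob_none_second_moment[where M = M and B = B and X = X, folded m_def] by linarith
  also have "\<dots> = m\<^sup>2 * (1 / m + r - 1)"
    using m Q by (simp add: field_simps power2_eq_square)
  finally have "measure_pmf.prob M {x. \<forall>e\<in>X. x \<notin> B e} \<le> 1 / m + r - 1"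
    using m Q by (simp add: mult_le_cancel_left)
  also have "1 / m \<le> 1 / (card X * q)"
    using m Q by (intro divide_left_mono mult_pos_pos[of m]) auto
  finally show ?thesis by simp
qed

text \<open>The constant 21 is the largest integer allowed at \<open>d = 3\<close>, where the claim
  reads 63 against 64.\<close>

lemma twenty_one_mult_le_four_power: "3 \<le> d \<Longrightarrow> 21 * d \<le> 4 ^ d" for d :: nat
  by (induction d rule: dec_induct) auto

text \<open>With \<open>N\<close> equal to \<open>n\<close> to the power
  \<open>1 / (2 * d ^ 2)\<close>, the range of \<open>p\<close> and the size condition on
  \<open>n\<close> become inequalities between natural powers of \<open>N\<close>.\<close>

locale diameter_regime =
  fixes n d :: nat and p N :: real
  assumes d: "3 \<le> d" and p: "0 < p" "p < 1"
    and n_eq: "real n = N ^ (2 * d ^ 2)" and N_gt: "4 ^ d * real d < N"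
    and np_ge: "N ^ (2 * d) \<le> n * p" and np_le: "n * p \<le> N ^ (2 * d + 1)"
begin

interpretation random_subset_avoidance "vertex_pairs n" p
  using p by unfold_locales (auto simp: finite_vertex_pairs)

lemma d_le: "21 * (real d)\<^sup>2 \<le> 4 ^ d * d"
proof -
  have "21 * d * d \<le> 4 ^ d * d"
    using twenty_one_mult_le_four_power[OF d] by (rule mult_right_mono) simp
  then have "real (21 * d * d) \<le> real (4 ^ d * d)" by (simp only: of_nat_le_iff)
  then show ?thesis by (simp add: power2_eq_square)
qed

lemma d_sq_ge: "9 \<le> (real d)\<^sup>2"
  using d power_mono[of 3 "real d" 2] by simp

lemma N_gt_189: "189 < N" and d_sq_less_N: "21 * (real d)\<^sup>2 < N" and N_pos: "0 < N"
proof -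
  have "21 * (real d)\<^sup>2 < N" using d_le N_gt by simp
  then show "189 < N" "21 * (real d)\<^sup>2 < N" "0 < N" using d_sq_ge by linarith+
qed

lemma d_less_N: "real d < N"
proof -
  have "real d * 1 \<le> real d * real d" using d by (intro mult_left_mono) auto
  then show ?thesis using d_sq_less_N by (simp add: power2_eq_square)
qed

lemma n_pos: "0 < real n"
  using N_pos by (simp add: n_eq)

lemma n_gt_N: "N < real n"
proof -
  have "1 < 2 * d ^ 2" using d power_mono[of 3 d 2] by simp
  then have "N ^ 1 < N ^ (2 * d ^ 2)"
    using N_gt_189 by (intro power_strict_increasing) auto
  then show ?thesis by (simp add: n_eq)
qed

lemma np_power_le: "(n * p) ^ j \<le> N ^ ((2 * d + 1) * j)"
  using np_le p by (subst power_mult) (intro power_mono, auto)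

lemma one_le_np: "1 \<le> n * p"
  using np_ge one_le_power[of N "2 * d"] N_gt_189 by linarith

text \<open>Multiplying by \<open>n ^ 2 * N\<close> turns the left side into
  \<open>d ^ 2 * (n * p) ^ d * N\<close>, and exponents of \<open>N\<close> can be compared. It
  bounds the loss from vertex sequences that are not paths.\<close>

lemma d_sq_mult_le: "(real d)\<^sup>2 * p ^ d * real n ^ (d - 2) \<le> 1 / N"
proof -
  have "real n ^ d = real n ^ (d - 2) * real n ^ 2"
  proof -
    have "d = d - 2 + 2" using d by simp
    then show ?thesis by (metis power_add)
  qed
  then have "((real d)\<^sup>2 * p ^ d * real n ^ (d - 2) * N) * real n ^ 2 = (real d)\<^sup>2 * (n * p) ^ d * N"
    by (simp add: power_mult_distrib mult_ac)
  also have "\<dots> \<le> N ^ 2 * N ^ ((2 * d + 1) * d) * N"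
    using N_pos p d_less_N by (intro mult_mono np_power_le power_mono) auto
  also have "\<dots> = N ^ ((2 * d + 1) * d + 3)"
    by (simp add: power_add power2_eq_square power3_eq_cube mult_ac)
  also have "\<dots> \<le> N ^ (2 * d ^ 2 * 2)"
  proof (rule power_increasing)
    obtain k where "d = k + 3" using d by (metis add.commute le_Suc_ex)
    then show "(2 * d + 1) * d + 3 \<le> 2 * d ^ 2 * 2"
      by (simp add: power2_eq_square algebra_simps)
  qed (use N_gt_189 in simp)
  also have "\<dots> = 1 * real n ^ 2" by (simp only: n_eq power_mult mult_1)
  finally have "(real d)\<^sup>2 * p ^ d * real n ^ (d - 2) * N \<le> 1"
    by (rule mult_right_le_imp_le) (use n_pos in simp)
  then show ?thesis using N_pos by (simp add: pos_le_divide_eq)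
qed

text \<open>The exponents match exactly: \<open>(2 * d + 1) * (2 * d - 1) + 1 = 4 * d ^ 2\<close>.
  The upper bound on \<open>p\<close> is used here without any slack.\<close>

lemma correlation_le: "p ^ (2 * d - 1) * real n ^ (2 * d - 3) \<le> 1 / N"
proof -
  have "real n ^ (2 * d - 1) = real n ^ (2 * d - 3) * real n ^ 2"
  proof -
    have "2 * d - 1 = 2 * d - 3 + 2" using d by simp
    then show ?thesis by (metis power_add)
  qed
  then have "(p ^ (2 * d - 1) * real n ^ (2 * d - 3) * N) * real n ^ 2 = (n * p) ^ (2 * d - 1) * N"
    by (simp add: power_mult_distrib mult_ac)
  also have "\<dots> \<le> N ^ ((2 * d + 1) * (2 * d - 1)) * N"
    using N_pos by (intro mult_right_mono np_power_le) auto
  also have "\<dots> = N ^ ((2 * d + 1) * (2 * d - 1) + 1)" by simp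
  also have "(2 * d + 1) * (2 * d - 1) + 1 = 2 * d ^ 2 * 2"
  proof -
    obtain k where "d = Suc k" using d by (cases d) auto
    then show ?thesis by (simp add: power2_eq_square algebra_simps)
  qed
  also have "N ^ (2 * d ^ 2 * 2) = 1 * real n ^ 2" by (simp only: n_eq power_mult mult_1)
  finally have "p ^ (2 * d - 1) * real n ^ (2 * d - 3) * N \<le> 1"
    by (rule mult_right_le_imp_le) (use n_pos in simp)
  then show ?thesis using N_pos by (simp add: pos_le_divide_eq)
qed

lemma sum_shorter_paths_le: "(\<Sum>k=1..d - 1. real (n ^ (k - 1)) * p ^ k) \<le> 1 / N"
proof -
  have bound: "real (n ^ (k - 1)) * p ^ k \<le> 1 / (d * N)" if k: "k \<in> {1..d - 1}" for k
  proof -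
    have "real n ^ k = real n * real n ^ (k - 1)" using k by (cases k) auto
    then have "(real (n ^ (k - 1)) * p ^ k * (d * N)) * real n = d * (n * p) ^ k * N"
      by (simp add: power_mult_distrib mult_ac)
    \<comment> \<open>Since \<open>n * p\<close> is at least 1, the length \<open>d - 1\<close>
      dominates.\<close>
    also have "\<dots> \<le> d * (n * p) ^ (d - 1) * N"
      using k one_le_np N_pos by (intro mult_right_mono mult_left_mono power_increasing) auto
    also have "\<dots> \<le> N * N ^ ((2 * d + 1) * (d - 1)) * N"
      using N_pos p d_less_N by (intro mult_mono np_power_le) auto
    also have "\<dots> = N ^ ((2 * d + 1) * (d - 1) + 2)"
      by (simp add: power_add power2_eq_square mult_ac)
    also have "\<dots> \<le> N ^ (2 * d ^ 2)"
    proof (rule power_increasing)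
      obtain k where "d = Suc (Suc k)" using d by (cases d; cases "d - 1") auto
      then show "(2 * d + 1) * (d - 1) + 2 \<le> 2 * d ^ 2"
        by (simp add: power2_eq_square algebra_simps)
    qed (use N_gt_189 in simp)
    also have "\<dots> = 1 * real n" by (simp add: n_eq)
    finally have "real (n ^ (k - 1)) * p ^ k * (d * N) \<le> 1"
      by (rule mult_right_le_imp_le) (use n_pos in simp)
    then show ?thesis using N_pos d by (simp add: pos_le_divide_eq)
  qed
  have "(\<Sum>k=1..d - 1. real (n ^ (k - 1)) * p ^ k) \<le> (\<Sum>k=1..d - 1. 1 / (d * N))"
    by (rule sum_mono[OF bound])
  also have "\<dots> \<le> d * (1 / (d * N))"
    using N_pos by (simp only: sum_constant) (rule mult_right_mono, auto)
  also have "\<dots> = 1 / N" using d by simp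
  finally show ?thesis .
qed

lemma p_power_d_le: "p ^ d \<le> 1 / N"
proof -
  have "1 \<le> (real d)\<^sup>2 * real n ^ (d - 2)"
    using d_sq_ge n_gt_N N_gt_189 mult_mono[of 1 "(real d)\<^sup>2" 1 "real n ^ (d - 2)"] by simp
  then have "p ^ d * 1 \<le> p ^ d * ((real d)\<^sup>2 * real n ^ (d - 2))"
    using p by (intro mult_left_mono) auto
  also have "\<dots> \<le> 1 / N" using d_sq_mult_le by (simp add: mult_ac)
  finally show ?thesis by simp
qed

text \<open>The probability that no path of length \<open>d\<close> joins a fixed pair, as if there
  were \<open>n ^ (d - 1)\<close> independent candidates.\<close>

abbreviation avoid_prob :: real where
  "avoid_prob \<equiv> (1 - p ^ d) ^ (n ^ (d - 1))"

lemma avoid_prob_pos: "0 < avoid_prob"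
  using p d by (simp add: power_less_one_iff)

lemma prob_avoids_short_paths_lower:
  assumes "e \<in> ordered_pairs n"
  shows "avoid_prob * (1 - 1 / N) \<le> prob (avoids path_edges (short_paths n d e))"
proof -
  have "1 - 1 / N \<le> 1 - (\<Sum>k=1..d - 1. real (n ^ (k - 1)) * p ^ k)"
    using sum_shorter_paths_le by simp
  also have "\<dots> \<le> (\<Prod>k=1..d - 1. (1 - p ^ k) ^ (n ^ (k - 1)))"
    using p by (intro one_minus_sum_le_prod) (auto simp: power_le_one)
  finally have "avoid_prob * (1 - 1 / N) \<le> avoid_prob * (\<Prod>k=1..d - 1. (1 - p ^ k) ^ (n ^ (k - 1)))"
    using avoid_prob_pos by (intro mult_left_mono) auto
  also have "\<dots> = (\<Prod>k=1..d. (1 - p ^ k) ^ (n ^ (k - 1)))"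
  proof -
    obtain k where "d = Suc k" using d by (cases d) auto
    then show ?thesis by (simp add: prod.nat_ivl_Suc')
  qed
  also have "\<dots> \<le> prob (avoids path_edges (short_paths n d e))"
    using p assms by (rule prob_avoids_short_paths_ge)
  finally show ?thesis .
qed

text \<open>The exponents differ by \<open>D\<close>, at most \<open>d ^ 2 * n ^ (d - 2)\<close>, so
  by Bernoulli's inequality the discrepancy is a factor of at least
  \<open>1 - 1 / N\<close>.\<close>

lemma avoid_prob_falling_le: "(1 - p ^ d) ^ ((n - d) ^ (d - 1)) \<le> avoid_prob / (1 - 1 / N)"
proof -
  define D where "D = n ^ (d - 1) - (n - d) ^ (d - 1)"
  have D_add: "n ^ (d - 1) = (n - d) ^ (d - 1) + D"
    unfolding D_def by (simp add: power_mono)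
  have dn: "d \<le> n" using d_less_N n_gt_N by simp
  obtain k where k: "d - 1 = Suc k" "d - 2 = k" using d by (cases "d - 1") auto
  have "real D = (real (n - d) + real d) ^ Suc k - real (n - d) ^ Suc k"
    unfolding D_def k(1) using dn by (simp add: of_nat_diff power_mono del: power_Suc)
  also have "\<dots> \<le> Suc k * real d * (real (n - d) + real d) ^ k"
    by (rule power_diff_le) auto
  also have "real (n - d) + real d = real n" using dn by simp
  also have "Suc k * real d * real n ^ k \<le> (real d)\<^sup>2 * real n ^ (d - 2)"
    unfolding k(1)[symmetric] k(2) power2_eq_square by (intro mult_right_mono mult_mono) auto
  finally have "D * p ^ d \<le> (real d)\<^sup>2 * real n ^ (d - 2) * p ^ d"
    using p by (intro mult_right_mono) auto
  also have "\<dots> \<le> 1 / N" using d_sq_mult_le by (simp add: mult_ac)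
  finally have "1 - 1 / N \<le> 1 + D * (- (p ^ d))" by simp
  also have "\<dots> \<le> (1 - p ^ d) ^ D"
    using Bernoulli_inequality[of "- (p ^ d)" D] p by (simp add: power_le_one)
  finally have "(1 - p ^ d) ^ ((n - d) ^ (d - 1)) * (1 - 1 / N) \<le>
      (1 - p ^ d) ^ ((n - d) ^ (d - 1)) * (1 - p ^ d) ^ D"
    using p by (intro mult_left_mono) (auto simp: power_le_one)
  also have "\<dots> = avoid_prob"
    by (simp only: D_add power_add)
  finally show ?thesis
    using N_gt_189 by (subst pos_le_divide_eq) (auto simp: field_simps)
qed

lemma correlation_sum_le:
  assumes m: "d = m + 2"
  shows "real n ^ (m + 1) *
      (real (Suc m) * real (m + 3) * p ^ (2 * m + 3) * (real n + real (m + 3) / p) ^ m) \<le>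
    2 * (real d)\<^sup>2 / N"
proof -
  \<comment> \<open>The relative correction that the weights \<open>1 / p\<close> add to
    \<open>n\<close>. As \<open>n * p\<close> is at least \<open>N\<close>, which exceeds
    \<open>21 * d ^ 2\<close>, its \<open>m\<close>-th power effect stays below a factor 2.\<close>
  define x where "x = real (m + 3) / (n * p)"
  have x: "0 \<le> x" using p by (simp add: x_def)
  have N_np: "N \<le> n * p"
    using np_ge power_increasing[of 1 "2 * d" N] N_gt_189 d by simp
  have "m * (m + 3) \<le> d ^ 2" by (simp add: m power2_eq_square algebra_simps)
  then have "real (m * (m + 3)) \<le> real (d ^ 2)" by (simp only: of_nat_le_iff)
  then have "real (m * (m + 3)) \<le> n * p / 2"
    using d_sq_less_N N_np d_sq_ge by simp
  then have mx: "m * x \<le> 1 / 2"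
    using N_np N_pos by (simp add: x_def field_simps)
  have "real n + real (m + 3) / p = n * (1 + x)"
    using n_pos p by (simp add: x_def field_simps)
  then have "(real n + real (m + 3) / p) ^ m = real n ^ m * (1 + x) ^ m"
    by (simp only: power_mult_distrib)
  also have "(1 + x) ^ m \<le> exp x ^ m"
    using x by (intro power_mono exp_ge_add_one_self) auto
  also have "exp x ^ m = exp (m * x)" by (simp add: exp_of_nat_mult)
  also have "exp (m * x) \<le> 1 + m * x + (m * x)\<^sup>2"
    using x mx by (intro exp_bound) auto
  also have "\<dots> \<le> 1 + 1 / 2 + (1 / 2)\<^sup>2"
    using x mx by (intro add_mono power_mono) auto
  also have "\<dots> \<le> 2" by (simp add: power2_eq_square)
  finally have pow: "(real n + real (m + 3) / p) ^ m \<le> real n ^ m * 2"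
    using n_pos by (simp add: mult_left_mono)
  have "Suc m * (m + 3) \<le> d ^ 2" by (simp add: m power2_eq_square algebra_simps)
  then have "real (Suc m * (m + 3)) \<le> real (d ^ 2)" by (simp only: of_nat_le_iff)
  then have dd: "real (Suc m) * real (m + 3) \<le> (real d)\<^sup>2" by (simp only: of_nat_mult of_nat_power)
  have "real n ^ (m + 1) *
      (real (Suc m) * real (m + 3) * p ^ (2 * m + 3) * (real n + real (m + 3) / p) ^ m) \<le>
      real n ^ (m + 1) * ((real d)\<^sup>2 * p ^ (2 * m + 3) * (real n ^ m * 2))"
    using p by (intro mult_left_mono mult_mono dd pow) auto
  also have "\<dots> = 2 * (real d)\<^sup>2 * (p ^ (2 * d - 1) * real n ^ (2 * d - 3))"
  proof -
    have "2 * d - 1 = 2 * m + 3" "2 * d - 3 = m + 1 + m" by (auto simp: m)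
    then show ?thesis by (simp only: power_add mult_ac)
  qed
  also have "\<dots> \<le> 2 * (real d)\<^sup>2 * (1 / N)"
    by (intro mult_left_mono correlation_le) auto
  finally show ?thesis by simp
qed

lemma prob_avoids_all_short_paths_upper:
  assumes T: "T \<subseteq> ordered_pairs n"
  shows "prob (\<lambda>R. \<forall>e\<in>T. avoids path_edges (short_paths n d e) R) \<le>
    (avoid_prob / (1 - 1 / N)) ^ card T * exp (4 * (real (card T))\<^sup>2 * (real d)\<^sup>2 / N)"
proof -
  define m where "m = d - 2"
  have m: "d = m + 2" using d by (simp add: m_def)
  define \<delta> where "\<delta> = real (Suc m) * real (m + 3) * p ^ (2 * m + 3) * (real n + real (m + 3) / p) ^ m"
  define I where "I = (\<Union>(u, v)\<in>T. paths n d u v)"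
  define t where "t = card T"
  define c where "c = 1 - p ^ d"
  have \<delta>: "0 \<le> \<delta>" using p by (simp add: \<delta>_def)
  have c: "1 / 2 \<le> c" "c \<le> 1"
  proof -
    have "1 / N \<le> 1 / 2" using N_gt_189 by (intro divide_left_mono) auto
    then show "1 / 2 \<le> c" using p_power_d_le by (simp add: c_def)
    show "c \<le> 1" using p by (simp add: c_def)
  qed
  have dn: "d < n" using d_less_N n_gt_N by simp
  have card_I: "card I = (\<Sum>(u, v)\<in>T. card (paths n d u v))"
    unfolding I_def by (rule card_UN_paths[OF T])
  have I_le: "card I \<le> t * n ^ (m + 1)"
  proof -
    have "card I \<le> (\<Sum>e\<in>T. n ^ (m + 1))"
      unfolding card_I
    proof (rule sum_mono)
      fix e assume "e \<in> T"
      then obtain u v where "e = (u, v)" "u < v" "v < n" using T by (auto simp: ordered_pairs_def)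
      then show "(case e of (u, v) \<Rightarrow> card (paths n d u v)) \<le> n ^ (m + 1)"
        using card_paths_le[of u n v "m + 1"] by (simp add: m)
    qed
    then show ?thesis by (simp add: t_def)
  qed
  have I_ge: "t * (n - d) ^ (d - 1) \<le> card I"
  proof -
    have "(\<Sum>e\<in>T. (n - d) ^ (d - 1)) \<le> card I"
      unfolding card_I
    proof (rule sum_mono)
      fix e assume "e \<in> T"
      then obtain u v where "e = (u, v)" "u < v" "v < n" using T by (auto simp: ordered_pairs_def)
      then show "(n - d) ^ (d - 1) \<le> (case e of (u, v) \<Rightarrow> card (paths n d u v))"
        using card_paths_ge[of u n v "m + 1"] dn by (simp add: m)
    qed
    then show ?thesis by (simp add: t_def)
  qed
  have "prob (\<lambda>R. \<forall>e\<in>T. avoids path_edges (short_paths n d e) R) \<le> (c + t * \<delta>) ^ card I"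
    using prob_avoids_all_short_paths_le[OF p T, of m] unfolding I_def \<delta>_def c_def t_def m .
  \<comment> \<open>Splitting off \<open>c\<close> separates the two uses of \<open>card I\<close>:
    the power of \<open>c\<close> calls for a lower bound on it, the exponential for an upper
    one.\<close>
  also have "c + t * \<delta> = c * (1 + t * \<delta> / c)" using c by (simp add: field_simps)
  also have "(c * (1 + t * \<delta> / c)) ^ card I \<le> (c * exp (t * \<delta> / c)) ^ card I"
    using c \<delta> by (intro power_mono mult_left_mono exp_ge_add_one_self) auto
  also have "\<dots> = c ^ card I * exp (card I * (t * \<delta> / c))"
    by (simp only: power_mult_distrib exp_of_nat_mult)
  also have "\<dots> \<le> (avoid_prob / (1 - 1 / N)) ^ t * exp (4 * (real t)\<^sup>2 * (real d)\<^sup>2 / N)"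
  proof (rule mult_mono)
    have "c ^ card I \<le> c ^ (t * (n - d) ^ (d - 1))"
      using I_ge c by (intro power_decreasing) auto
    also have "\<dots> = (c ^ ((n - d) ^ (d - 1))) ^ t"
      by (simp add: power_mult[symmetric] mult.commute)
    also have "\<dots> \<le> (avoid_prob / (1 - 1 / N)) ^ t"
      using avoid_prob_falling_le c by (intro power_mono) (auto simp: c_def)
    finally show "c ^ card I \<le> (avoid_prob / (1 - 1 / N)) ^ t" .
    have "t * \<delta> / c \<le> t * \<delta> / (1 / 2)"
      using c \<delta> by (intro divide_left_mono) auto
    then have "card I * (t * \<delta> / c) \<le> real (t * n ^ (m + 1)) * (t * \<delta> / (1 / 2))"
    proof (intro mult_mono)
      show "real (card I) \<le> real (t * n ^ (m + 1))" using I_le by (simp only: of_nat_le_iff)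
      show "0 \<le> t * \<delta> / c" using c \<delta> by (intro divide_nonneg_nonneg) auto
    qed auto
    also have "\<dots> = 2 * (real t)\<^sup>2 * (real n ^ (m + 1) * \<delta>)"
      by (simp add: power2_eq_square mult_ac)
    also have "\<dots> \<le> 2 * (real t)\<^sup>2 * (2 * (real d)\<^sup>2 / N)"
      unfolding \<delta>_def by (intro mult_left_mono correlation_sum_le m) auto
    also have "\<dots> = 4 * (real t)\<^sup>2 * (real d)\<^sup>2 / N" by simp
    finally show "exp (card I * (t * \<delta> / c)) \<le> exp (4 * (real t)\<^sup>2 * (real d)\<^sup>2 / N)" by simp
  qed (use avoid_prob_pos N_gt_189 in auto)
  finally show ?thesis by (simp only: t_def)
qed

end

section \<open>The bounds on the diameter\<close>

context diameter_regime
begin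

interpretation random_subset_avoidance "vertex_pairs n" p
  using p by unfold_locales (auto simp: finite_vertex_pairs)

text \<open>These bounds let every later error estimate be linear in
  \<open>d ^ 2 / N\<close>.\<close>

lemma error_terms:
  "0 < 1 / N" "1 / N \<le> 1 / 189" "9 * (1 / N) \<le> (real d)\<^sup>2 / N" "(real d)\<^sup>2 / N \<le> 1 / 21"
  "21 * ((real d)\<^sup>2 / N) \<le> 4 ^ d * d * (1 / N)"
  using N_gt_189 d_sq_less_N d_sq_ge d_le by (auto simp: field_simps)

lemma single_pair_error_less: "exp (4 * (real d)\<^sup>2 / N) / (1 - 1 / N) < 1 + 4 ^ (d + 1) * real d * (1 / N)"
proof -
  define x where "x = (real d)\<^sup>2 / N"
  define \<epsilon> where "\<epsilon> = 1 / N"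
  note e = error_terms[folded x_def \<epsilon>_def]
  have x: "0 \<le> x" "0 < x" using e by linarith+
  have "exp (4 * (real d)\<^sup>2 / N) = exp (4 * x)" by (simp add: x_def)
  also have "\<dots> \<le> 1 + 4 * x + (4 * x)\<^sup>2" using x e by (intro exp_bound) auto
  also have "(4 * x)\<^sup>2 \<le> 16 / 21 * x"
    using mult_right_mono[OF e(4), of x] x by (simp add: power2_eq_square)
  \<comment> \<open>The 84 is 4 times 21, so \<open>84 * x\<close> is at most
    \<open>4 ^ (d + 1) * d / N\<close>.\<close>
  also have "1 + 4 * x + 16 / 21 * x < (1 - \<epsilon>) * (1 + 84 * x)"
  proof -
    have "\<epsilon> * x \<le> 1 / 189 * x" using e x by (intro mult_right_mono) auto
    moreover have "(1 - \<epsilon>) * (1 + 84 * x) = 1 + 84 * x - \<epsilon> - 84 * (\<epsilon> * x)"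
      by (simp add: algebra_simps)
    ultimately show ?thesis using e(1,3) by linarith
  qed
  also have "\<dots> \<le> (1 - \<epsilon>) * (1 + 4 ^ (d + 1) * real d * \<epsilon>)"
    using e by (intro mult_left_mono) (auto simp: mult_ac)
  finally show ?thesis
    using e by (subst pos_divide_less_eq) (auto simp: \<epsilon>_def mult.commute)
qed

text \<open>Of the four factors \<open>1 - 1 / N\<close>, two come from the upper bound for two
  pairs and two from dividing by the square of the single-pair lower bound. The 16 is 4 times the
  square of the number of pairs.\<close>

lemma two_pairs_error_less:
  "exp (16 * (real d)\<^sup>2 / N) / (1 - 1 / N) ^ 4 - 1 < 4 ^ (d + 2) * real d * (1 / N)"
proof -
  define x where "x = (real d)\<^sup>2 / N"
  define \<epsilon> where "\<epsilon> = 1 / N"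
  note e = error_terms[folded x_def \<epsilon>_def]
  have x: "0 \<le> x" "0 < x" using e by linarith+
  have "exp (16 * (real d)\<^sup>2 / N) = exp (16 * x)" by (simp add: x_def)
  also have "\<dots> \<le> 1 + 16 * x + (16 * x)\<^sup>2" using x e by (intro exp_bound) auto
  also have "(16 * x)\<^sup>2 \<le> 256 / 21 * x"
    using mult_right_mono[OF e(4), of x] x by (simp add: power2_eq_square)
  also have "1 + 16 * x + 256 / 21 * x < (1 - 4 * \<epsilon>) * (1 + 336 * x)"
  proof -
    have "\<epsilon> * x \<le> 1 / 189 * x" using e x by (intro mult_right_mono) auto
    moreover have "(1 - 4 * \<epsilon>) * (1 + 336 * x) = 1 + 336 * x - 4 * \<epsilon> - 1344 * (\<epsilon> * x)"
      by (simp add: algebra_simps)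
    ultimately show ?thesis using e(1,3) by linarith
  qed
  also have "\<dots> \<le> (1 - \<epsilon>) ^ 4 * (1 + 4 ^ (d + 2) * real d * \<epsilon>)"
  proof (rule mult_mono)
    show "1 - 4 * \<epsilon> \<le> (1 - \<epsilon>) ^ 4" using Bernoulli_inequality[of "- \<epsilon>" 4] e by simp
  qed (use e x in \<open>auto simp: mult_ac\<close>)
  finally have "exp (16 * (real d)\<^sup>2 / N) / (1 - 1 / N) ^ 4 < 1 + 4 ^ (d + 2) * real d * (1 / N)"
    using e by (subst pos_divide_less_eq) (auto simp: \<epsilon>_def mult.commute)
  then show ?thesis by simp
qed

lemma card_pairs_pos: "0 < n choose 2"
proof -
  have "2 \<le> n" using n_gt_N N_gt_189 by linarith
  then show ?thesis by simp
qed

lemma prob_diameter_le_lower: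
  "1 - real (n choose 2) * avoid_prob * (1 + 4 ^ (d + 1) * real d * (1 / N)) < prob_diameter_le n p d"
proof -
  let ?A = "\<lambda>e. {R. avoids path_edges (short_paths n d e) R}"
  have "1 - prob_diameter_le n p d = measure_pmf.prob (random_subset (vertex_pairs n) p) (\<Union>e\<in>ordered_pairs n. ?A e)"
    unfolding prob_diameter_le_eq by (subst measure_pmf.prob_compl[symmetric]) (auto intro!: arg_cong[where f = "measure_pmf.prob _"])
  also have "\<dots> \<le> (\<Sum>e\<in>ordered_pairs n. prob (avoids path_edges (short_paths n d e)))"
    by (intro measure_pmf.finite_measure_subadditive_finite finite_ordered_pairs) auto
  also have "\<dots> \<le> (\<Sum>e\<in>ordered_pairs n. avoid_prob * (exp (4 * (real d)\<^sup>2 / N) / (1 - 1 / N)))"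
  proof (rule sum_mono)
    fix e assume "e \<in> ordered_pairs n"
    then show "prob (avoids path_edges (short_paths n d e)) \<le> avoid_prob * (exp (4 * (real d)\<^sup>2 / N) / (1 - 1 / N))"
      using prob_avoids_all_short_paths_upper[of "{e}"] by simp
  qed
  also have "\<dots> = real (n choose 2) * avoid_prob * (exp (4 * (real d)\<^sup>2 / N) / (1 - 1 / N))"
    by (simp add: card_ordered_pairs)
  also have "\<dots> < real (n choose 2) * avoid_prob * (1 + 4 ^ (d + 1) * real d * (1 / N))"
    using single_pair_error_less card_pairs_pos avoid_prob_pos by (intro mult_strict_left_mono) auto
  finally show ?thesis by simp
qed

lemma prob_diameter_le_upper:
  "prob_diameter_le n p d <
    2 * inverse avoid_prob * (1 + 2 * (1 / N)) / (real n * (real n - 1)) + 4 ^ (d + 2) * real d * (1 / N)"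
proof -
  let ?A = "\<lambda>e. {R. avoids path_edges (short_paths n d e) R}"
  let ?M = "random_subset (vertex_pairs n) p"
  define q where "q = avoid_prob * (1 - 1 / N)"
  \<comment> \<open>The ratio between the upper bound for two distinct pairs and \<open>q\<close>
    squared.\<close>
  define r where "r = exp (16 * (real d)\<^sup>2 / N) / (1 - 1 / N) ^ 4"
  have e: "0 < 1 - 1 / N" using error_terms(2) by linarith
  have q: "0 < q" using avoid_prob_pos e by (simp add: q_def)
  have "prob_diameter_le n p d \<le> 1 / (card (ordered_pairs n) * q) + r - 1"
    unfolding prob_diameter_le_eq
  proof (rule prob_none_second_moment_uniform[where B = ?A, simplified mem_Collect_eq])
    show "ordered_pairs n \<noteq> {}" using card_pairs_pos card_ordered_pairs[of n] by auto
    show "0 \<le> r" using e by (simp add: r_def)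
  next
    fix e assume "e \<in> ordered_pairs n"
    then show "q \<le> measure_pmf.prob ?M (?A e)"
      unfolding q_def by (rule prob_avoids_short_paths_lower)
  next
    fix e f assume ef: "e \<in> ordered_pairs n" "f \<in> ordered_pairs n" "e \<noteq> f"
    have "?A e \<inter> ?A f = {R. \<forall>g\<in>{e, f}. avoids path_edges (short_paths n d g) R}" by auto
    then have "measure_pmf.prob ?M (?A e \<inter> ?A f) \<le>
        (avoid_prob / (1 - 1 / N)) ^ 2 * exp (16 * (real d)\<^sup>2 / N)"
      using prob_avoids_all_short_paths_upper[of "{e, f}"] ef by (simp add: power2_eq_square)
    also have "\<dots> = r * q\<^sup>2"
    proof -
      have alg: "(a / b) ^ 2 * c = c / b ^ 4 * (a * b)\<^sup>2" if "b \<noteq> 0" for a b c :: real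
        using that by (simp add: field_simps power_numeral_reduce)
      have "1 - 1 / N \<noteq> 0" using e by (metis less_irrefl)
      then show ?thesis unfolding r_def q_def by (rule alg)
    qed
    finally show "measure_pmf.prob ?M (?A e \<inter> ?A f) \<le> r * q\<^sup>2" .
  qed (use q finite_ordered_pairs in auto)
  also have "1 / (card (ordered_pairs n) * q) \<le>
      2 * inverse avoid_prob * (1 + 2 * (1 / N)) / (real n * (real n - 1))"
  proof -
    have "1 \<le> (1 - 1 / N) * (1 + 2 * (1 / N))"
      using error_terms(1,2) N_gt_189 by (simp add: field_simps)
    then have *: "1 / (1 - 1 / N) \<le> 1 + 2 * (1 / N)"
      using e by (simp add: pos_divide_le_eq mult.commute)
    have n: "1 < real n" using n_gt_N N_gt_189 by linarith
    have "real (card (ordered_pairs n)) = real n * (real n - 1) / 2"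
      unfolding card_ordered_pairs choose_two using n by (simp add: real_of_nat_div of_nat_diff)
    moreover have alg: "1 / (a / 2 * (b * c)) = 2 * inverse b / a * (1 / c)" for a b c :: real
      by (simp add: field_simps)
    ultimately have "1 / (card (ordered_pairs n) * q) =
        2 * inverse avoid_prob / (real n * (real n - 1)) * (1 / (1 - 1 / N))"
      by (simp only: q_def alg)
    also have "\<dots> \<le> 2 * inverse avoid_prob / (real n * (real n - 1)) * (1 + 2 * (1 / N))"
      using avoid_prob_pos n by (intro mult_left_mono *) auto
    finally show ?thesis by (simp only: times_divide_eq_left)
  qed
  finally show ?thesis using two_pairs_error_less by (simp add: r_def)
qed

end

theorem corollary6p1:
  fixes n d :: nat and p :: real
  assumes "d \<ge> 3" and "n > 0" and "0 < p" and "p < 1"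
    and "real n powr (1 / real d - 1) \<le> p"
    and "p \<le> real n powr (1 / real d + 1 / (2 * real d ^ 2) - 1)"
    and "(4 ^ d * d) ^ (2 * d ^ 2) < n"
  shows "prob_diameter_le n p d >
      1 - real (n choose 2) * (1 - p ^ d) ^ (n ^ (d - 1))
            * (1 + 4 ^ (d + 1) * real d * real n powr (- 1 / (2 * real d ^ 2)))
    \<and> prob_diameter_le n p d <
      2 * (1 - p ^ d) powi (- int (n ^ (d - 1)))
          * (1 + 2 * real n powr (- 1 / (2 * real d ^ 2))) / (real n * (real n - 1))
        + 4 ^ (d + 2) * real d * real n powr (- 1 / (2 * real d ^ 2))"
proof -
  define N where "N = real n powr (1 / (2 * real d ^ 2))"
  have N: "0 < N" using assms(2) by (simp add: N_def)
  have N_power: "N ^ k = real n powr (k / (2 * real d ^ 2))" for k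
    using N by (simp add: N_def powr_realpow[symmetric] powr_powr)
  interpret diameter_regime n d p N
  proof
    show n_eq: "real n = N ^ (2 * d ^ 2)"
      using assms(1,2) by (simp add: N_power)
    have "(4 ^ d * real d) ^ (2 * d ^ 2) = real ((4 ^ d * d) ^ (2 * d ^ 2))" by simp
    also have "\<dots> < N ^ (2 * d ^ 2)"
      unfolding n_eq[symmetric] using assms(7) by (simp only: of_nat_less_iff)
    finally show "4 ^ d * real d < N"
      by (rule power_less_imp_less_base) (use N in simp)
    \<comment> \<open>Multiplying the bounds on \<open>p\<close> by \<open>n\<close> leaves the
      exponents \<open>1 / d = 2 * d / (2 * d ^ 2)\<close> and
      \<open>(2 * d + 1) / (2 * d ^ 2)\<close>, that is, natural powers of \<open>N\<close>.\<close>
    have shift: "real n * real n powr (a - 1) = real n powr a" for a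
      using assms(2) by (simp add: powr_diff)
    have "N ^ (2 * d) = real n * real n powr (1 / real d - 1)"
      using assms(1) by (simp add: shift N_power power2_eq_square)
    also have "\<dots> \<le> real n * p" using assms(5) by (intro mult_left_mono) auto
    finally show "N ^ (2 * d) \<le> real n * p" .
    have "real n * p \<le> real n * real n powr (1 / real d + 1 / (2 * real d ^ 2) - 1)"
      using assms(6) by (intro mult_left_mono) auto
    also have "\<dots> = N ^ (2 * d + 1)"
      unfolding N_power shift using assms(1) by (simp add: power2_eq_square add_divide_distrib add.commute)
    finally show "real n * p \<le> N ^ (2 * d + 1)" .
  qed (use assms in auto)
  have "real n powr (- 1 / (2 * real d ^ 2)) = 1 / N"
    by (simp add: N_def powr_minus_divide)
  moreover have "(1 - p ^ d) powi (- int (n ^ (d - 1))) = inverse ((1 - p ^ d) ^ (n ^ (d - 1)))"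
    by (simp only: power_int_minus power_int_of_nat)
  ultimately show ?thesis
    using prob_diameter_le_lower prob_diameter_le_upper by (simp only:)
qed

end
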